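(* The Jacobian of each of the following three genus-$2$ curves over $\mathbb{Q}$ has a $\mathbb{Q}$-rational torsion point of order exactly $27$: \begin{align*} y^2 + (x^3 - 2 x + 1)\, y &= x^3,\\ y^2 + (2 x^3 + 3 x^2 - 3 x + 2)\, y &= 6 x^3 + 6,\\ y^2 + (6 x^3 + 9 x^2 + 6 x - 1)\, y &= -3 x^2, \end{align*} and the Jacobian of the genus-$2$ curve \[ y^2 + (6 x^3 + 6 x^2 - 7 x - 9)\, y = -2 x - 2 \] over $\mathbb{Q}$ has a $\mathbb{Q}$-rational torsion point of order exactly $39$.
   Context: A genus-$2$ curve given by an affine equation $y^2 + h(x) y = f(x)$, with $\deg h \le 3$ and $\deg f\le 6$, means the smooth projective geometrically irreducible curve over $\mathbb{Q}$ with that affine model. Its Jacobian is the associated principally polarized abelian surface over $\mathbb{Q}$, and "rational" means defined over $\mathbb{Q}$. *)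

theory Defs
  imports
    "HOL-Algebra.Algebraic_Closure_Type"
    "HOL-Algebra.Free_Abelian_Groups"
    "HOL-Algebra.Multiplicative_Group"
    "HOL-Computational_Algebra.Computational_Algebra"
    "HOL-Library.Product_Plus"
begin

type_synonym Qbar = "rat alg_closure"

abbreviation base_change :: "rat poly \<Rightarrow> Qbar poly" where
  "base_change \<equiv> map_poly to_ac"

text \<open>
  The curve \<open>y\<^sup>2 + h(x) y = f(x)\<close>, \<open>deg h \<le> 3\<close>, \<open>deg f \<le> 6\<close>, has a projective model in the
  weighted projective plane P(1,3,1). It is covered by the affine curve and by the chart
  \<open>x = 1/z\<close>, \<open>y = w/z\<^sup>3\<close>, given by \<open>w\<^sup>2 + z\<^sup>3 h(1/z) w = z\<^sup>6 f(1/z)\<close>, and its points outside the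
  affine curve are those with \<open>z = 0\<close>. The model has arithmetic genus 2, so it is a geometrically
  irreducible curve of genus 2 exactly if it has no geometric singular point (for \<open>deg h \<le> 3\<close>,
  \<open>deg f \<le> 6\<close>, a smooth model is automatically irreducible). The two conditions below are the
  Jacobian criterion at the affine points and at the points \<open>(z, w) = (0, w)\<close>.
\<close>

definition genus2_model :: "rat poly \<Rightarrow> rat poly \<Rightarrow> bool" where
  "genus2_model h f \<longleftrightarrow>
     Polynomial.degree h \<le> 3 \<and> Polynomial.degree f \<le> 6 \<and>
     (let H = base_change h; F = base_change f in
       (\<nexists>x y. y\<^sup>2 + poly H x * y = poly F x \<and>
              poly (pderiv H) x * y = poly (pderiv F) x \<and>
              2 * y + poly H x = 0) \<and>
       (\<nexists>w. w\<^sup>2 + Polynomial.coeff H 3 * w = Polynomial.coeff F 6 \<and>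
            Polynomial.coeff H 2 * w = Polynomial.coeff F 5 \<and>
            2 * w + Polynomial.coeff H 3 = 0))"

text \<open>
  The function field over the algebraic closure, \<open>K(x)[y] / (y\<^sup>2 + h y - f)\<close> with \<open>K\<close> the algebraic
  closure of the rationals: the pair \<open>(a, b)\<close> stands for \<open>a + b y\<close>. Addition and zero are those
  of pairs.
\<close>

type_synonym function_field = "Qbar poly fract \<times> Qbar poly fract"

definition ff_mult ::
    "rat poly \<Rightarrow> rat poly \<Rightarrow> function_field \<Rightarrow> function_field \<Rightarrow> function_field" where
  "ff_mult h f u v =
     (let H = to_fract (base_change h); F = to_fract (base_change f) in
       (fst u * fst v + snd u * snd v * F,
        fst u * snd v + snd u * fst v - snd u * snd v * H))"

definition ff_const :: "Qbar \<Rightarrow> function_field" where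
  "ff_const c = (to_fract [:c:], 0)"

text \<open>
  The geometric points of the smooth projective curve, as the normalised discrete valuations of
  its function field that are trivial on constants; a point is identified with the order of
  vanishing at it. The value at \<open>0\<close> (properly infinity) is set to \<open>0\<close>, so that
  each point is represented by exactly one function.
\<close>

definition places :: "rat poly \<Rightarrow> rat poly \<Rightarrow> (function_field \<Rightarrow> int) set" where
  "places h f = {v.
     v 0 = 0 \<and>
     (\<forall>a b. a \<noteq> 0 \<longrightarrow> b \<noteq> 0 \<longrightarrow> v (ff_mult h f a b) = v a + v b) \<and>
     (\<forall>a b. a \<noteq> 0 \<longrightarrow> b \<noteq> 0 \<longrightarrow> a + b \<noteq> 0 \<longrightarrow> min (v a) (v b) \<le> v (a + b)) \<and>
     (\<forall>c. c \<noteq> 0 \<longrightarrow> v (ff_const c) = 0) \<and>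
     (\<exists>t. t \<noteq> 0 \<and> v t = 1)}"

type_synonym divisor = "(function_field \<Rightarrow> int) \<Rightarrow>\<^sub>0 int"

definition deg_divisor :: "divisor \<Rightarrow> int" where
  "deg_divisor D = (\<Sum>P\<in>Poly_Mapping.keys D. Poly_Mapping.lookup D P)"

definition divisors_deg0 :: "rat poly \<Rightarrow> rat poly \<Rightarrow> divisor set" where
  "divisors_deg0 h f = {D \<in> carrier (free_Abelian_group (places h f)). deg_divisor D = 0}"

text \<open>
  Divisors of functions have degree 0; the restriction to \<open>divisors_deg0\<close> therefore excludes none.
\<close>

definition principal_divisors :: "rat poly \<Rightarrow> rat poly \<Rightarrow> divisor set" where
  "principal_divisors h f =
     {D \<in> divisors_deg0 h f. \<exists>g. g \<noteq> 0 \<and> (\<forall>P\<in>places h f. Poly_Mapping.lookup D P = P g)}"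

text \<open>
  The group of geometric points of the Jacobian is the group of classes of divisors of degree 0
  on the curve over the algebraic closure, compatibly with the Galois actions; its rational
  points are the classes that are fixed by every automorphism of the algebraic closure. A class
  may be fixed without containing a fixed divisor, so the condition is on the class.
\<close>

definition jacobian :: "rat poly \<Rightarrow> rat poly \<Rightarrow> divisor set monoid" where
  "jacobian h f =
     (free_Abelian_group (places h f))\<lparr>carrier := divisors_deg0 h f\<rparr> Mod principal_divisors h f"

definition galois_group :: "(Qbar \<Rightarrow> Qbar) set" where
  "galois_group = {\<sigma>. bij \<sigma> \<and> (\<forall>a b. \<sigma> (a + b) = \<sigma> a + \<sigma> b) \<and>
     (\<forall>a b. \<sigma> (a * b) = \<sigma> a * \<sigma> b) \<and> (\<forall>q. \<sigma> (to_ac q) = to_ac q)}"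

definition galois_fract :: "(Qbar \<Rightarrow> Qbar) \<Rightarrow> Qbar poly fract \<Rightarrow> Qbar poly fract" where
  "galois_fract \<sigma> r =
     (let (p, q) = quot_of_fract r in Fract (map_poly \<sigma> p) (map_poly \<sigma> q))"

definition galois_ff :: "(Qbar \<Rightarrow> Qbar) \<Rightarrow> function_field \<Rightarrow> function_field" where
  "galois_ff \<sigma> u = (galois_fract \<sigma> (fst u), galois_fract \<sigma> (snd u))"

definition galois_place ::
    "(Qbar \<Rightarrow> Qbar) \<Rightarrow> (function_field \<Rightarrow> int) \<Rightarrow> (function_field \<Rightarrow> int)" where
  "galois_place \<sigma> P = (\<lambda>g. P (galois_ff (inv_into UNIV \<sigma>) g))"

definition galois_divisor :: "(Qbar \<Rightarrow> Qbar) \<Rightarrow> divisor \<Rightarrow> divisor" where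
  "galois_divisor \<sigma> D = frag_extend (\<lambda>P. frag_of (galois_place \<sigma> P)) D"

definition jacobian_rational_points :: "rat poly \<Rightarrow> rat poly \<Rightarrow> divisor set set" where
  "jacobian_rational_points h f =
     {C \<in> carrier (jacobian h f). \<forall>\<sigma>\<in>galois_group. galois_divisor \<sigma> ` C = C}"

definition has_rational_torsion_of_order :: "rat poly \<Rightarrow> rat poly \<Rightarrow> nat \<Rightarrow> bool" where
  "has_rational_torsion_of_order h f n \<longleftrightarrow>
     n > 0 \<and> (\<exists>C\<in>jacobian_rational_points h f. group.ord (jacobian h f) C = n)"

end

theory Submission
  imports Defs
begin

text \<open>
  Each of the four curves has two rational places at infinity. The order of their difference is
  read off from functions \<open>a + b y\<close> with \<open>a\<close>, \<open>b\<close> polynomials. If the norm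
  \<open>a\<^sup>2 - a b h - b\<^sup>2 f\<close> is constant, the function has neither zeros nor poles at finite places, and
  its divisor is a multiple of the difference. Conversely, if \<open>k\<close> times the difference is the
  divisor of \<open>g\<close>, multiplying the conjugate of \<open>g\<close> by a function of small norm gives a function with
  small poles at infinity only; such a function lies in \<open>K[x]\<close> and has the same order at both infinite
  places, which excludes the wrong \<open>k\<close>. The difference has order 27 on the first three curves and 13
  on the last one; there \<open>y - 2/9\<close> has a triple zero at \<open>(-1/3, 2/9)\<close>, which yields an independent
  class of order 3. All places involved are determined by the values of finitely many rational
  functions, hence they are fixed by the Galois group.
\<close>

section \<open>Polynomials and valuations\<close>

text \<open>A principal divisor is described by the values of one function at all places, and places
  are abstract valuations. So the places that occur must be classified, and enough of them must be
  shown to exist. Uniqueness comes from an iteration that reduces a valuation to its restriction to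
  K(x); existence comes from Laurent series parametrizations. Existence carries the negative
  results: a function without finite poles can be recognised as a polynomial only if there is a
  place above every c.

  The hypotheses deg h = 3 and deg f <= 3 separate the two branches at infinity: on one of them y is
  close to f/h, on the other to -h. The values at infinity of the functions a + b y in use are then
  read off from degrees, so what remains for a concrete curve is a computation with rational
  polynomials: a Bezout identity for smoothness, a constant norm for a principal multiple, the
  degree of a norm for a multiple that is not principal.\<close>

lemma map_poly_hom_add:
  assumes "f 0 = 0" "\<And>a b. f (a + b) = f a + f b"
  shows "map_poly f (p + q) = map_poly f p + map_poly f q"
  by (rule poly_eqI) (simp add: coeff_map_poly assms)

lemma map_poly_hom_mult:
  fixes f :: "'a::comm_semiring_0 \<Rightarrow> 'b::comm_semiring_0"
  assumes "f 0 = 0" "\<And>a b. f (a + b) = f a + f b" "\<And>a b. f (a * b) = f a * f b"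
  shows "map_poly f (p * q) = map_poly f p * map_poly f q"
proof -
  have "f (sum g A) = (\<Sum>x\<in>A. f (g x))" for g :: "nat \<Rightarrow> 'a" and A
    by (induction A rule: infinite_finite_induct) (simp_all add: assms)
  then show ?thesis
    by (intro poly_eqI) (simp add: coeff_map_poly coeff_mult assms)
qed

lemma poly_map_poly_hom:
  assumes "f 0 = 0" "\<And>a b. f (a + b) = f a + f b" "\<And>a b. f (a * b) = f a * f b"
  shows "poly (map_poly f p) (f x) = f (poly p x)"
  by (induction p) (simp_all add: map_poly_pCons assms)

text \<open>Stated through common roots with the derivative, since this is what the Jacobian
  criterion in \<open>genus2_model\<close> rules out for h^2 + 4 f.\<close>

definition squarefree_poly :: "'a::field poly \<Rightarrow> bool" where
  "squarefree_poly d \<longleftrightarrow> (\<forall>x. \<not> (poly d x = 0 \<and> poly (pderiv d) x = 0))"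

lemma squarefree_poly_square_dvd:
  fixes d q :: "'a::alg_closed_field poly"
  assumes "squarefree_poly d" "q\<^sup>2 dvd d"
  shows "Polynomial.degree q = 0"
proof (rule ccontr)
  assume "Polynomial.degree q \<noteq> 0"
  then obtain x where x: "poly q x = 0"
    using alg_closed_imp_poly_has_root by blast
  obtain r where "d = q\<^sup>2 * r" using assms(2) by auto
  then have "poly d x = 0 \<and> poly (pderiv d) x = 0"
    using x by (simp add: power2_eq_square pderiv_mult)
  with assms(1) show False unfolding squarefree_poly_def by blast
qed

text \<open>An even power of the variable splits off, and the remaining unit has a square root as a
  power series: its constant term has one, and in characteristic 0 \<open>fps_radical\<close> lifts
  it.\<close>

lemma fls_sqrt_exists:
  fixes Z :: "'a::{alg_closed_field,field_char_0} fls"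
  assumes "even (fls_subdegree Z)"
  shows "\<exists>S. S\<^sup>2 = Z"
proof (cases "Z = 0")
  case False
  define A where "A = fls_base_factor_to_fps Z"
  have A0: "A $ 0 \<noteq> 0" using False by (simp add: A_def)
  obtain s where s: "s\<^sup>2 = A $ 0"
    using nth_root_exists[of 2 "A $ 0"] by auto
  have B: "(fps_radical (\<lambda>_ _. s) (Suc 1) A) ^ Suc 1 = A"
    using power_radical[OF A0, of "\<lambda>_ _. s" 1] s by (simp add: numeral_2_eq_2)
  define B where "B = fps_to_fls (fps_radical (\<lambda>_ _. s) (Suc 1) A)"
  have B2: "B\<^sup>2 = fls_base_factor Z"
    using B unfolding B_def A_def
    by (metis Suc_1 fps_to_fls_power fps_to_fls_base_factor_to_fps)
  obtain k where k: "fls_subdegree Z = 2 * k" using assms by auto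
  have "(fls_shift (- k) B)\<^sup>2 = fls_shift (- fls_subdegree Z) (B\<^sup>2)"
    by (simp add: power2_eq_square fls_shifted_times_simps k)
  also have "\<dots> = Z" by (simp add: B2)
  finally show ?thesis by blast
qed (auto intro: exI[of _ 0])

text \<open>Covers both the restriction of a place to K[x] and the order of p(\<xi>) for a Laurent
  series \<xi>. No uniformizer is demanded, since at a branch point all values on K[x] are
  even.\<close>

locale poly_valuation =
  fixes \<nu> :: "'a::field poly \<Rightarrow> int"
  assumes val_mult: "p \<noteq> 0 \<Longrightarrow> q \<noteq> 0 \<Longrightarrow> \<nu> (p * q) = \<nu> p + \<nu> q"
    and val_add: "p \<noteq> 0 \<Longrightarrow> q \<noteq> 0 \<Longrightarrow> p + q \<noteq> 0 \<Longrightarrow> min (\<nu> p) (\<nu> q) \<le> \<nu> (p + q)"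
    and val_const: "c \<noteq> 0 \<Longrightarrow> \<nu> [:c:] = 0"
begin

lemma val_power: "p \<noteq> 0 \<Longrightarrow> \<nu> (p ^ n) = int n * \<nu> p"
proof (induction n)
  case 0
  then show ?case using val_const[of 1] by (simp add: one_pCons)
qed (simp add: val_mult algebra_simps)

lemma val_minus: "p \<noteq> 0 \<Longrightarrow> \<nu> (- p) = \<nu> p"
  using val_mult[of "[:-1:]" p] val_const[of "-1"] by simp

text \<open>If p + q had a larger value than p, so would p = (p + q) - q. The alternative
  \<open>q = 0\<close> stands for an infinite value, as \<nu> 0 is arbitrary.\<close>

lemma val_add_dominant:
  assumes "p \<noteq> 0" "q = 0 \<or> \<nu> p < \<nu> q"
  shows "p + q \<noteq> 0" "\<nu> (p + q) = \<nu> p"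
proof -
  have "p + q \<noteq> 0 \<and> \<nu> (p + q) = \<nu> p" 
  proof (cases "q = 0")
    case False
    have n0: "p + q \<noteq> 0"
      using assms False val_minus[of p] by (auto simp: add_eq_0_iff)
    have "min (\<nu> (p + q)) (\<nu> (-q)) \<le> \<nu> p"
      using val_add[of "p + q" "-q"] assms False n0 by simp
    moreover have "min (\<nu> p) (\<nu> q) \<le> \<nu> (p + q)" using val_add assms False n0 by blast
    ultimately show ?thesis using assms False n0 val_minus[of q] by auto
  qed (use assms in auto)
  then show "p + q \<noteq> 0" "\<nu> (p + q) = \<nu> p" by auto
qed

lemma val_nonneg:
  assumes "\<nu> [:0, 1:] \<ge> 0" "p \<noteq> 0"
  shows "\<nu> p \<ge> 0"
  using assms(2)
proof (induction p)
  case (pCons a p)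
  show ?case
  proof (cases "p = 0")
    case True
    then show ?thesis using pCons val_const by auto
  next
    case False
    have eq: "pCons a p = [:a:] + [:0, 1:] * p" by simp
    have x: "\<nu> ([:0, 1:] * p) \<ge> 0" 
      using val_mult[of "[:0, 1:]" p] False assms(1) pCons.IH by (simp del: mult_pCons_left)
    show ?thesis
    proof (cases "a = 0")
      case True
      then show ?thesis using x by simp
    next
      case a: False
      have "min (\<nu> [:a:]) (\<nu> ([:0, 1:] * p)) \<le> \<nu> (pCons a p)"
        unfolding eq by (rule val_add) (use a False in auto)
      then show ?thesis using x val_const[OF a] by auto
    qed
  qed
qed auto

text \<open>By Horner's scheme: x p has negative value, so adding a constant cannot change
  it.\<close>

lemma val_at_infinity:
  assumes "\<nu> [:0, 1:] < 0" "p \<noteq> 0"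
  shows "\<nu> p = int (Polynomial.degree p) * \<nu> [:0, 1:]"
  using assms(2)
proof (induction p)
  case (pCons a p)
  show ?case
  proof (cases "p = 0")
    case True
    then show ?thesis using pCons val_const by auto
  next
    case False
    have eq: "pCons a p = [:0, 1:] * p + [:a:]" by simp
    have x: "\<nu> ([:0, 1:] * p) = int (Suc (Polynomial.degree p)) * \<nu> [:0, 1:]"
      using val_mult[of "[:0, 1:]" p] False pCons by (simp add: algebra_simps)
    then have "\<nu> ([:0, 1:] * p) < 0"
      using assms(1) by (simp only: mult_less_0_iff) auto
    then have "\<nu> (pCons a p) = \<nu> ([:0, 1:] * p)"
      unfolding eq using val_const[of a] False
      by (intro val_add_dominant) (cases "a = 0"; simp del: mult_pCons_left)+
    then show ?thesis using x False by (simp add: algebra_simps)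
  qed
qed auto

text \<open>A polynomial that does not vanish at a is a nonzero constant plus a multiple of x - a,
  hence has value 0; only the power of x - a counts.\<close>

lemma val_at_point:
  assumes "\<nu> [:-a, 1:] > 0" "p \<noteq> 0"
  shows "\<nu> p = int (Polynomial.order a p) * \<nu> [:-a, 1:]"
proof -
  have x: "\<nu> [:0, 1:] \<ge> 0"
  proof (cases "a = 0")
    case False
    have "min (\<nu> [:-a, 1:]) (\<nu> [:a:]) \<le> \<nu> ([:-a, 1:] + [:a:])"
      using False by (intro val_add) auto
    then show ?thesis using assms val_const[OF False] by simp
  qed (use assms in simp)
  have unit: "\<nu> q = 0" if q: "poly q a \<noteq> 0" for q
  proof -
    obtain s where s: "q = [:-a, 1:] * s + [:poly q a:]"
    proof -
      have "[:-a, 1:] dvd q - [:poly q a:]" by (simp flip: poly_eq_0_iff_dvd)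
      then show ?thesis using that by (auto simp: dvd_def algebra_simps)
    qed
    show ?thesis
    proof (cases "s = 0")
      case True
      then show ?thesis using s val_const[OF q] by (metis add_0 mult_zero_right)
    next
      case False
      then have "\<nu> ([:-a, 1:] * s) > 0"
        using val_mult[of "[:-a, 1:]" s] val_nonneg[OF x False] assms by simp
      then have "\<nu> ([:poly q a:] + [:-a, 1:] * s) = \<nu> [:poly q a:]"
        using q val_const[OF q] by (intro val_add_dominant) auto
      also have "[:poly q a:] + [:-a, 1:] * s = q" using s by (metis add.commute)
      finally show ?thesis using val_const[OF q] by simp
    qed
  qed
  obtain q where q: "p = [:-a, 1:] ^ Polynomial.order a p * q" "\<not> [:-a, 1:] dvd q"
    using order_decomp[OF assms(2)] by blast
  then have "\<nu> q = 0" "q \<noteq> 0" using unit by (auto simp: poly_eq_0_iff_dvd)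
  then have "\<nu> ([:-a, 1:] ^ Polynomial.order a p * q) = int (Polynomial.order a p) * \<nu> [:-a, 1:]"
    by (simp add: val_mult val_power)
  then show ?thesis using q(1) by metis
qed

end

section \<open>The function field\<close>

lemma base_change_add: "base_change (p + q) = base_change p + base_change q"
  and base_change_mult: "base_change (p * q) = base_change p * base_change q"
  by (rule map_poly_hom_add map_poly_hom_mult; simp)+

lemma base_change_diff: "base_change (p - q) = base_change p - base_change q"
  by (rule poly_eqI) (simp add: coeff_map_poly)

lemma degree_base_change [simp]: "Polynomial.degree (base_change p) = Polynomial.degree p"
  by (simp add: degree_map_poly)

lemma base_change_eq_0_iff [simp]: "base_change p = 0 \<longleftrightarrow> p = 0"
  by (simp add: map_poly_eq_0_iff)

locale genus2_curve =
  fixes h f :: "rat poly"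
  assumes model: "genus2_model h f"
    and deg_h: "Polynomial.degree h = 3"
    and deg_f: "Polynomial.degree f \<le> 3"
    and f_nonzero: "f \<noteq> 0"
begin

abbreviation "H \<equiv> to_fract (base_change h)"
abbreviation "F \<equiv> to_fract (base_change f)"

abbreviation fmult :: "function_field \<Rightarrow> function_field \<Rightarrow> function_field" (infixl "\<circledast>" 70)
  where "u \<circledast> w \<equiv> ff_mult h f u w"

abbreviation rat_fun :: "Qbar poly fract \<Rightarrow> function_field" where "rat_fun r \<equiv> (r, 0)"
abbreviation poly_fun :: "Qbar poly \<Rightarrow> function_field" where "poly_fun p \<equiv> rat_fun (to_fract p)"
abbreviation y_fun :: function_field where "y_fun \<equiv> (0, 1)"

text \<open>The hyperelliptic involution y -> - h - y.\<close>

definition ff_conj :: "function_field \<Rightarrow> function_field" where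
  "ff_conj u = (fst u - snd u * H, - snd u)"

definition ff_norm :: "function_field \<Rightarrow> Qbar poly fract" where
  "ff_norm u = (fst u)\<^sup>2 - fst u * snd u * H - (snd u)\<^sup>2 * F"

text \<open>The discriminant of the quadratic equation of y, that is, (2 y + h)^2.\<close>

definition disc :: "Qbar poly" where
  "disc = (base_change h)\<^sup>2 + 4 * base_change f"

lemma fmult_eq: "(a, b) \<circledast> (c, e) = (a * c + b * e * F, a * e + b * c - b * e * H)"
  by (simp add: ff_mult_def Let_def)

lemma fmult_comm: "u \<circledast> w = w \<circledast> u"
  by (cases u; cases w) (simp add: fmult_eq algebra_simps)

lemma fmult_assoc: "u \<circledast> w \<circledast> z = u \<circledast> (w \<circledast> z)"
  by (cases u; cases w; cases z) (simp add: fmult_eq algebra_simps)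

lemma rat_fun_mult: "rat_fun r \<circledast> rat_fun s = rat_fun (r * s)"
  by (simp add: fmult_eq)

lemma ff_conj_conj [simp]: "ff_conj (ff_conj u) = u"
  by (simp add: ff_conj_def)

lemma ff_conj_rat_fun [simp]: "ff_conj (rat_fun r) = rat_fun r"
  by (simp add: ff_conj_def)

lemma ff_conj_add: "ff_conj (u + w) = ff_conj u + ff_conj w"
  by (simp add: ff_conj_def algebra_simps)

lemma ff_conj_mult: "ff_conj (u \<circledast> w) = ff_conj u \<circledast> ff_conj w"
  by (cases u; cases w) (simp add: ff_conj_def fmult_eq algebra_simps power2_eq_square)

lemma ff_conj_eq_0_iff [simp]: "ff_conj u = 0 \<longleftrightarrow> u = 0"
  by (cases u) (auto simp: ff_conj_def zero_prod_def)

lemma fmult_ff_conj: "u \<circledast> ff_conj u = rat_fun (ff_norm u)"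
  by (cases u) (simp add: ff_conj_def ff_norm_def fmult_eq algebra_simps power2_eq_square)

section \<open>The discriminant and the field property\<close>

lemma degree_disc: "Polynomial.degree disc = 6"
proof -
  have "Polynomial.degree ((base_change h)\<^sup>2) = 6"
    using deg_h by (subst degree_power_eq) auto
  moreover have "Polynomial.degree (4 * base_change f) \<le> 3"
    using degree_mult_le[of 4 "base_change f"] deg_f by simp
  ultimately show ?thesis
    unfolding disc_def by (simp add: degree_add_eq_left)
qed

text \<open>A multiple root x of the discriminant would give the singular point (x, - h(x)/2),
  against \<open>genus2_model\<close>.\<close>

lemma squarefree_disc: "squarefree_poly disc"
  unfolding squarefree_poly_def
proof (intro allI notI)
  fix x assume x: "poly disc x = 0 \<and> poly (pderiv disc) x = 0"
  let ?H = "base_change h" and ?F = "base_change f"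
  define y where "y = - poly ?H x / 2"
  have d: "(poly ?H x)\<^sup>2 + 4 * poly ?F x = 0" using x by (simp add: disc_def)
  have d': "2 * poly ?H x * poly (pderiv ?H) x + 4 * poly (pderiv ?F) x = 0"
    using x by (simp add: disc_def pderiv_add pderiv_mult power2_eq_square pderiv_numeral algebra_simps)
  have hx: "poly ?H x = - 2 * y" by (simp add: y_def)
  have zero: "z = 0" if "4 * z = 0" for z :: Qbar using that by simp
  have "y\<^sup>2 + poly ?H x * y - poly ?F x = 0"
  proof (rule zero)
    have "4 * (y\<^sup>2 + poly ?H x * y - poly ?F x) = - ((poly ?H x)\<^sup>2 + 4 * poly ?F x)"
      unfolding hx by (simp add: power2_eq_square algebra_simps)
    then show "4 * (y\<^sup>2 + poly ?H x * y - poly ?F x) = 0" using d by simp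
  qed
  moreover have "poly (pderiv ?H) x * y - poly (pderiv ?F) x = 0"
  proof (rule zero)
    have "4 * (poly (pderiv ?H) x * y - poly (pderiv ?F) x)
        = - (2 * poly ?H x * poly (pderiv ?H) x + 4 * poly (pderiv ?F) x)"
      unfolding hx by (simp add: algebra_simps)
    then show "4 * (poly (pderiv ?H) x * y - poly (pderiv ?F) x) = 0" using d' by simp
  qed
  moreover have "2 * y + poly ?H x = 0" using hx by simp
  ultimately have "y\<^sup>2 + poly ?H x * y = poly ?F x \<and> poly (pderiv ?H) x * y = poly (pderiv ?F) x \<and>
      2 * y + poly ?H x = 0" by simp
  then show False using model unfolding genus2_model_def Let_def by blast
qed

text \<open>If b = p/q in lowest terms, then q^2 divides p^2 \<open>disc\<close>, hence
  \<open>disc\<close>, and squarefreeness leaves only constant q.\<close>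

lemma square_times_disc_poly:
  assumes "b\<^sup>2 * to_fract disc = to_fract w"
  shows "\<exists>p. b = to_fract p"
proof -
  obtain p q where pq: "quot_of_fract b = (p, q)" by fastforce
  have q0: "q \<noteq> 0" using snd_quot_of_fract_nonzero[of b] pq by simp
  have b: "b = to_fract p / to_fract q"
    using Fract_quot_of_fract[of b] pq by (simp add: Fract_conv_to_fract)
  have cop: "coprime p q" using coprime_quot_of_fract[of b] pq by simp
  have "to_fract (p\<^sup>2 * disc) = to_fract (w * q\<^sup>2)"
    using assms q0 by (simp add: b field_simps power2_eq_square)
  then have "p\<^sup>2 * disc = w * q\<^sup>2" by (simp only: to_fract_eq_iff)
  then have "q\<^sup>2 dvd p\<^sup>2 * disc" by simp
  moreover have "coprime (q\<^sup>2) (p\<^sup>2)" using cop by (simp add: coprime_commute)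
  ultimately have "q\<^sup>2 dvd disc" using coprime_dvd_mult_right_iff by blast
  then have "Polynomial.degree q = 0" using squarefree_disc squarefree_poly_square_dvd by blast
  then obtain c where c: "q = [:c:]" by (meson degree_eq_zeroE)
  then have "to_fract p = to_fract (smult (inverse c) p) * to_fract q"
    using q0 by (simp flip: to_fract_mult)
  then show ?thesis using b q0 by (metis nonzero_eq_divide_eq to_fract_eq_0_iff)
qed

text \<open>Were r a square root, (1/r)^2 \<open>disc\<close> = 1 would make 1/r a polynomial and
  \<open>disc\<close> a unit, but its degree is 6. This is the irreducibility of the equation of y
  over K(x).\<close>

lemma disc_not_square: "r\<^sup>2 \<noteq> to_fract disc"
proof
  assume r: "r\<^sup>2 = to_fract disc"
  have "disc \<noteq> 0" using degree_disc by auto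
  then have "r \<noteq> 0" using r by auto
  then have "(1 / r)\<^sup>2 * to_fract disc = to_fract 1"
    by (simp add: power_divide flip: r)
  then obtain p where p: "1 / r = to_fract p" using square_times_disc_poly by blast
  then have "to_fract (p\<^sup>2 * disc) = to_fract 1"
    using \<open>r \<noteq> 0\<close> \<open>disc \<noteq> 0\<close> by (simp add: power2_eq_square flip: p r)
  then have "p\<^sup>2 * disc = 1" by (simp only: to_fract_eq_iff)
  then have "is_unit disc" by (metis dvd_triv_right)
  then show False using degree_disc is_unit_iff_degree[OF \<open>disc \<noteq> 0\<close>] by simp
qed

lemma to_fract_disc: "to_fract disc = H\<^sup>2 + 4 * F"
proof -
  have "4 * base_change f = base_change f + base_change f + base_change f + base_change f" by simp
  then show ?thesis by (simp only: disc_def power2_eq_square to_fract_add to_fract_mult) simp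
qed

text \<open>This is what makes the pairs a field: conj u / norm u inverts u. By completing the
  square, a vanishing norm with nonzero b would turn (2 a - b h) / b into a square root of
  \<open>disc\<close>.\<close>

lemma ff_norm_eq_0_iff [simp]: "ff_norm u = 0 \<longleftrightarrow> u = 0"
proof
  assume n: "ff_norm u = 0"
  have eq: "(2 * fst u - snd u * H)\<^sup>2 = (snd u)\<^sup>2 * to_fract disc + 4 * ff_norm u"
    by (simp add: ff_norm_def to_fract_disc algebra_simps power2_eq_square)
  have "snd u = 0"
  proof (rule ccontr)
    assume "snd u \<noteq> 0"
    then have "((2 * fst u - snd u * H) / snd u)\<^sup>2 = to_fract disc"
      using eq n by (simp add: field_simps power2_eq_square)
    then show False using disc_not_square by blast
  qed
  then show "u = 0" using n by (simp add: ff_norm_def prod_eq_iff)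
qed (simp add: ff_norm_def)

lemma fmult_eq_0_iff: "u \<circledast> w = 0 \<longleftrightarrow> u = 0 \<or> w = 0"
proof
  assume uw: "u \<circledast> w = 0"
  have "rat_fun (ff_norm u * ff_norm w) = (u \<circledast> w) \<circledast> (ff_conj u \<circledast> ff_conj w)"
    unfolding rat_fun_mult[symmetric] fmult_ff_conj[symmetric]
    by (metis fmult_assoc fmult_comm)
  also have "\<dots> = 0" using uw by (simp add: ff_mult_def Let_def zero_prod_def)
  finally have "ff_norm u * ff_norm w = 0" by (simp add: zero_prod_def)
  then show "u = 0 \<or> w = 0" by simp
qed (auto simp: ff_mult_def Let_def zero_prod_def)

lemma inverse_exists:
  assumes "u \<noteq> 0" shows "\<exists>w. w \<noteq> 0 \<and> u \<circledast> w = rat_fun 1"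
proof -
  have "u \<circledast> (ff_conj u \<circledast> rat_fun (1 / ff_norm u)) = rat_fun 1"
    using assms by (simp add: fmult_ff_conj rat_fun_mult flip: fmult_assoc)
  moreover from this have "ff_conj u \<circledast> rat_fun (1 / ff_norm u) \<noteq> 0"
    using fmult_eq_0_iff by (metis fst_conv fst_zero one_neq_zero)
  ultimately show ?thesis by blast
qed

section \<open>Places\<close>

lemma place_mult: "v \<in> places h f \<Longrightarrow> a \<noteq> 0 \<Longrightarrow> b \<noteq> 0 \<Longrightarrow> v (a \<circledast> b) = v a + v b"
  unfolding places_def by blast

lemma place_add:
  "v \<in> places h f \<Longrightarrow> a \<noteq> 0 \<Longrightarrow> b \<noteq> 0 \<Longrightarrow> a + b \<noteq> 0 \<Longrightarrow> min (v a) (v b) \<le> v (a + b)"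
  unfolding places_def by blast

lemma place_const: "v \<in> places h f \<Longrightarrow> c \<noteq> 0 \<Longrightarrow> v (poly_fun [:c:]) = 0"
  by (simp add: places_def ff_const_def)

lemma place_zero: "v \<in> places h f \<Longrightarrow> v 0 = 0"
  unfolding places_def by blast

lemma place_uniformizer: "v \<in> places h f \<Longrightarrow> \<exists>t. t \<noteq> 0 \<and> v t = 1"
  unfolding places_def by blast

lemma rat_fun_eq_0_iff [simp]: "rat_fun r = 0 \<longleftrightarrow> r = 0"
  by (simp add: zero_prod_def)

lemma poly_valuation_place:
  assumes "v \<in> places h f"
  shows "poly_valuation (\<lambda>p. v (poly_fun p))"
proof
  fix p q :: "Qbar poly" assume "p \<noteq> 0" "q \<noteq> 0"
  then show "v (poly_fun (p * q)) = v (poly_fun p) + v (poly_fun q)"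
    using place_mult[OF assms, of "poly_fun p" "poly_fun q"] by (simp add: rat_fun_mult)
next
  fix p q :: "Qbar poly" assume "p \<noteq> 0" "q \<noteq> 0" "p + q \<noteq> 0"
  moreover have "to_fract p + to_fract q \<noteq> 0"
    using \<open>p + q \<noteq> 0\<close> by (simp flip: to_fract_add)
  ultimately show "min (v (poly_fun p)) (v (poly_fun q)) \<le> v (poly_fun (p + q))"
    using place_add[OF assms, of "poly_fun p" "poly_fun q"] by simp
qed (use place_const[OF assms] in simp)

lemma place_one: "v \<in> places h f \<Longrightarrow> v (rat_fun 1) = 0"
  using place_const[of v 1] by (simp flip: one_pCons)

lemma fmult_minus_one: "poly_fun [:-1:] \<circledast> u = - u"
proof -
  have "[:-1:] = (- 1 :: Qbar poly)" by (simp add: one_pCons)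
  then show ?thesis by (cases u) (simp add: fmult_eq)
qed

lemma place_minus: "v \<in> places h f \<Longrightarrow> v (- u) = v u"
  using place_mult[of v "poly_fun [:-1:]" u] place_const[of v "-1"]
  by (cases "u = 0") (simp_all add: fmult_minus_one)

lemma place_add_dominant:
  assumes v: "v \<in> places h f" and "a \<noteq> 0" "b = 0 \<or> v a < v b"
  shows "a + b \<noteq> 0" "v (a + b) = v a"
proof -
  have "a + b \<noteq> 0 \<and> v (a + b) = v a"
  proof (cases "b = 0")
    case False
    have n0: "a + b \<noteq> 0"
      using assms False place_minus[OF v, of a] by (auto simp: add_eq_0_iff)
    have "min (v (a + b)) (v (-b)) \<le> v a"
      using place_add[OF v, of "a + b" "-b"] assms False n0 by simp
    moreover have "min (v a) (v b) \<le> v (a + b)" using place_add[OF v] assms False n0 by blast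
    ultimately show ?thesis using assms False n0 place_minus[OF v, of b] by auto
  qed (use assms in auto)
  then show "a + b \<noteq> 0" "v (a + b) = v a" by auto
qed

text \<open>Moves statements from a place to its conjugate; the second infinite place and the second
  point above c arise this way.\<close>

lemma place_conj:
  assumes "v \<in> places h f"
  shows "(\<lambda>u. v (ff_conj u)) \<in> places h f"
proof -
  obtain t where "t \<noteq> 0" "v t = 1" using place_uniformizer[OF assms] by blast
  then have "\<exists>t. t \<noteq> 0 \<and> v (ff_conj t) = 1" by (intro exI[of _ "ff_conj t"]) auto
  moreover have "min (v (ff_conj a)) (v (ff_conj b)) \<le> v (ff_conj (a + b))"
    if "a \<noteq> 0" "b \<noteq> 0" "a + b \<noteq> 0" for a b
    using place_add[OF assms, of "ff_conj a" "ff_conj b"] that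
    by (simp flip: ff_conj_add)
  moreover have "v (ff_conj (a \<circledast> b)) = v (ff_conj a) + v (ff_conj b)" if "a \<noteq> 0" "b \<noteq> 0" for a b
    using place_mult[OF assms, of "ff_conj a" "ff_conj b"] that by (simp add: ff_conj_mult)
  moreover have "v (ff_conj (ff_const c)) = 0" if "c \<noteq> 0" for c
    using place_const[OF assms that] by (simp add: ff_const_def)
  moreover have "v (ff_conj 0) = 0"
    using place_zero[OF assms] by (metis ff_conj_eq_0_iff)
  ultimately show ?thesis unfolding places_def by blast
qed

lemma place_norm:
  "v \<in> places h f \<Longrightarrow> u \<noteq> 0 \<Longrightarrow> v u + v (ff_conj u) = v (rat_fun (ff_norm u))"
  using place_mult[of v u "ff_conj u"] by (simp add: fmult_ff_conj)

lemma place_rat_fun: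
  assumes "v \<in> places h f" "r \<noteq> 0" "quot_of_fract r = (p, q)"
  shows "p \<noteq> 0" "q \<noteq> 0" "v (rat_fun r) = v (poly_fun p) - v (poly_fun q)"
proof -
  show p: "p \<noteq> 0" using assms(2,3) fst_quot_of_fract_eq_0_iff[of r] by simp
  show q: "q \<noteq> 0" using snd_quot_of_fract_nonzero[of r] assms(3) by simp
  have "r = to_fract p / to_fract q"
    using Fract_quot_of_fract[of r] assms(3) by (simp add: Fract_conv_to_fract)
  then have "rat_fun r \<circledast> poly_fun q = poly_fun p" using q by (simp add: rat_fun_mult)
  then show "v (rat_fun r) = v (poly_fun p) - v (poly_fun q)"
    using place_mult[OF assms(1), of "rat_fun r" "poly_fun q"] assms(2) q by simp
qed

subsection \<open>Uniqueness\<close>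

text \<open>
  With \<open>y = \<rho> + \<eta>\<close>, the residual equation is \<open>\<eta> (\<eta> + h') = f'\<close>. At a place where \<open>\<eta>\<close> is small
  compared with \<open>h'\<close>, the fixed point iteration \<open>Y \<mapsto> f' / (Y + h')\<close> stays in the rational functions
  of \<open>x\<close> and converges to \<open>\<eta>\<close>; so the valuation is determined by its values on functions of \<open>x\<close>.
\<close>

lemma places_determined_by_restriction:
  fixes \<rho> z :: "Qbar poly fract" and w :: "Qbar poly fract \<Rightarrow> int"
  defines "h' \<equiv> H + 2 * \<rho>" and "f' \<equiv> F - H * \<rho> - \<rho>\<^sup>2" and "\<eta> \<equiv> (- \<rho>, 1) :: function_field"
  assumes S: "S \<subseteq> places h f" and h': "h' \<noteq> 0"
    and small: "\<And>v. v \<in> S \<Longrightarrow> v (rat_fun h') < v \<eta> \<and> 2 * v (rat_fun h') < v (rat_fun f')"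
    and w: "\<And>v r. v \<in> S \<Longrightarrow> r \<noteq> 0 \<Longrightarrow> v (rat_fun r) = v (rat_fun z) * w r"
    and z: "\<And>v. v \<in> S \<Longrightarrow> v (rat_fun z) > 0"
  shows "v \<in> S \<Longrightarrow> v (rat_fun z) = 1" and "v \<in> S \<Longrightarrow> v' \<in> S \<Longrightarrow> v = v'"
proof -
  define Y where "Y = rec_nat (0 :: Qbar poly fract) (\<lambda>_ r. f' / (r + h'))"
  have Y0: "Y 0 = 0" and YS: "Y (Suc n) = f' / (Y n + h')" for n by (simp_all add: Y_def)
  have \<eta>0: "\<eta> \<noteq> 0" by (simp add: \<eta>_def zero_prod_def)
  have eq: "\<eta> \<circledast> (\<eta> + rat_fun h') = rat_fun f'"
    by (simp add: \<eta>_def h'_def f'_def fmult_eq power2_eq_square algebra_simps)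
  have "ff_norm \<eta> = - f'" by (simp add: \<eta>_def ff_norm_def f'_def)
  then have f0: "f' \<noteq> 0" using \<eta>0 ff_norm_eq_0_iff by (metis neg_equal_0_iff_equal)
  have sub_ne: "\<eta> - rat_fun r \<noteq> 0" for r by (simp add: \<eta>_def zero_prod_def)
  \<comment> \<open>Subtracting the equations of \<eta> and Y (n + 1) shows that one step multiplies
    the error by - f' / ((\<eta> + h') (Y n + h')). The denominator has value 2 v h', so by
    \<open>small\<close> at least 1 is gained per step.\<close>
  have approx: "Y n + h' \<noteq> 0 \<and> v (rat_fun (Y n + h')) = v (rat_fun h')
      \<and> v (\<eta> - rat_fun (Y n)) \<ge> v \<eta> + int n" if v: "v \<in> S" for v n
  proof (induction n)
    case 0
    then show ?case using h' by (simp add: Y0 flip: zero_prod_def)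
  next
    case (Suc n)
    have vp: "v \<in> places h f" using v S by auto
    let ?R = "Y n + h'"
    have R: "?R \<noteq> 0" "v (rat_fun ?R) = v (rat_fun h')" using Suc by auto
    have prod: "rat_fun (Y (Suc n)) \<circledast> rat_fun ?R = rat_fun f'"
      using R by (simp add: YS rat_fun_mult)
    have YS0: "Y (Suc n) \<noteq> 0" using R f0 by (simp add: YS)
    have vY: "v (rat_fun (Y (Suc n))) = v (rat_fun f') - v (rat_fun h')"
      using place_mult[OF vp, of "rat_fun (Y (Suc n))" "rat_fun ?R"] prod YS0 R by simp
    have sum: "rat_fun h' + rat_fun (Y (Suc n)) \<noteq> 0 \<and>
        v (rat_fun h' + rat_fun (Y (Suc n))) = v (rat_fun h')"
      using place_add_dominant[OF vp, of "rat_fun h'" "rat_fun (Y (Suc n))"] vY small[OF v] h' by auto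
    have e1: "rat_fun h' + \<eta> \<noteq> 0 \<and> v (rat_fun h' + \<eta>) = v (rat_fun h')"
      using place_add_dominant[OF vp, of "rat_fun h'" \<eta>] small[OF v] h' by auto
    have "(\<eta> - rat_fun (Y (Suc n))) \<circledast> (rat_fun h' + \<eta>) \<circledast> rat_fun ?R
        = rat_fun f' \<circledast> (- (\<eta> - rat_fun (Y n)))"
    proof -
      have "(\<eta> - rat_fun (Y (Suc n))) \<circledast> (rat_fun h' + \<eta>) \<circledast> rat_fun ?R
        = (\<eta> \<circledast> (\<eta> + rat_fun h')) \<circledast> rat_fun ?R
          - (rat_fun (Y (Suc n)) \<circledast> rat_fun ?R) \<circledast> (rat_fun h' + \<eta>)"
        by (cases \<eta>) (simp add: fmult_eq algebra_simps)
      also have "\<dots> = rat_fun f' \<circledast> (- (\<eta> - rat_fun (Y n)))"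
        unfolding eq prod by (cases \<eta>) (simp add: fmult_eq algebra_simps)
      finally show ?thesis .
    qed
    moreover have "- (\<eta> - rat_fun (Y n)) \<noteq> 0" "v (- (\<eta> - rat_fun (Y n))) = v (\<eta> - rat_fun (Y n))"
      using sub_ne place_minus[OF vp] by (metis neg_equal_0_iff_equal)+
    ultimately have "v (\<eta> - rat_fun (Y (Suc n))) + v (rat_fun h') + v (rat_fun h')
        = v (rat_fun f') + v (\<eta> - rat_fun (Y n))"
      using sub_ne e1 R f0 place_mult[OF vp, of "(\<eta> - rat_fun (Y (Suc n))) \<circledast> (rat_fun h' + \<eta>)" "rat_fun ?R"]
        place_mult[OF vp, of "\<eta> - rat_fun (Y (Suc n))" "rat_fun h' + \<eta>"]
        place_mult[OF vp, of "rat_fun f'" "- (\<eta> - rat_fun (Y n))"]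
      by (simp add: fmult_eq_0_iff)
    then show ?case using Suc small[OF v] sum by (simp add: add.commute)
  qed
  \<comment> \<open>Replacing \<eta> by Y n changes u by a multiple b of the error, whose value
    eventually exceeds v u.\<close>
  have limit: "\<exists>N. \<forall>n\<ge>N. r + b * Y n \<noteq> 0 \<and> v (rat_fun (r + b * Y n)) = v u"
    if v: "v \<in> S" and u: "u = rat_fun r + rat_fun b \<circledast> \<eta>" "u \<noteq> 0" for v u r b
  proof (cases "b = 0")
    case True
    then show ?thesis using u by (auto simp: \<eta>_def fmult_eq)
  next
    case b: False
    have vp: "v \<in> places h f" using v S by auto
    have "r + b * Y n \<noteq> 0 \<and> v (rat_fun (r + b * Y n)) = v u"
      if n: "n \<ge> nat (v u - v (rat_fun b) - v \<eta> + 1)" for n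
    proof -
      let ?d = "rat_fun b \<circledast> (- (\<eta> - rat_fun (Y n)))"
      have d: "- (\<eta> - rat_fun (Y n)) \<noteq> 0" using sub_ne by (metis neg_equal_0_iff_equal)
      have "v ?d = v (rat_fun b) + v (\<eta> - rat_fun (Y n))"
        using place_mult[OF vp _ d, of "rat_fun b"] b place_minus[OF vp, of "\<eta> - rat_fun (Y n)"] by simp
      then have "v u < v ?d" using approx[OF v, of n] n by linarith
      then have "u + ?d \<noteq> 0 \<and> v (u + ?d) = v u"
        using place_add_dominant[OF vp u(2), of ?d] by blast
      moreover have "u + ?d = rat_fun (r + b * Y n)"
        unfolding u by (simp add: \<eta>_def fmult_eq algebra_simps)
      ultimately show ?thesis by (metis rat_fun_eq_0_iff)
    qed
    then show ?thesis by blast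
  qed
  have decomp: "\<exists>r b. u = rat_fun r + rat_fun b \<circledast> \<eta>" for u
    by (intro exI[of _ "fst u + snd u * \<rho>"] exI[of _ "snd u"]) (cases u; simp add: \<eta>_def fmult_eq)
  \<comment> \<open>A uniformizer may be replaced by a function of x of value 1. All values of
    functions of x are multiples of v z, so v z = 1; as \<open>w\<close> does not depend on the
    place, two places of S then agree on K(x).\<close>
  show one: "v (rat_fun z) = 1" if v: "v \<in> S" for v
  proof -
    have vp: "v \<in> places h f" using v S by auto
    obtain t where t: "t \<noteq> 0" "v t = 1" using place_uniformizer[OF vp] by blast
    obtain r b where "t = rat_fun r + rat_fun b \<circledast> \<eta>" using decomp by blast
    then obtain s where "s \<noteq> 0" "v (rat_fun s) = v t" using limit[OF v _ t(1)] by blast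
    then have "1 = v (rat_fun z) * w s" using w[OF v] t by metis
    then show ?thesis using z[OF v] by (metis pos_zmult_eq_1_iff)
  qed
  show "v = v'" if v: "v \<in> S" "v' \<in> S" for v v'
  proof
    fix u
    show "v u = v' u"
    proof (cases "u = 0")
      case True
      then show ?thesis using place_zero v S by (metis subsetD)
    next
      case False
      obtain r b where u: "u = rat_fun r + rat_fun b \<circledast> \<eta>" using decomp by blast
      obtain N where N: "\<forall>n\<ge>N. r + b * Y n \<noteq> 0 \<and> v (rat_fun (r + b * Y n)) = v u"
        using limit[OF v(1) u False] by blast
      obtain N' where N': "\<forall>n\<ge>N'. r + b * Y n \<noteq> 0 \<and> v' (rat_fun (r + b * Y n)) = v' u"
        using limit[OF v(2) u False] by blast
      define s where "s = r + b * Y (max N N')"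
      have "s \<noteq> 0" "v (rat_fun s) = v u" "v' (rat_fun s) = v' u"
        using N N' unfolding s_def by auto
      then show ?thesis using w[OF v(1)] w[OF v(2)] one v by metis
    qed
  qed
qed

subsection \<open>Existence\<close>

definition fls_eval :: "Qbar fls \<Rightarrow> Qbar poly \<Rightarrow> Qbar fls" where
  "fls_eval \<xi> p = poly (map_poly fls_const p) \<xi>"

lemma fls_eval_add: "fls_eval \<xi> (p + q) = fls_eval \<xi> p + fls_eval \<xi> q"
  unfolding fls_eval_def by (subst map_poly_hom_add) (simp_all add: fls_plus_const)

lemma fls_eval_mult: "fls_eval \<xi> (p * q) = fls_eval \<xi> p * fls_eval \<xi> q"
  unfolding fls_eval_def by (subst map_poly_hom_mult) (simp_all add: fls_plus_const fls_const_mult_const)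

lemma fls_eval_linear: "fls_eval \<xi> [:a, 1:] = fls_const a + \<xi>"
  by (simp add: fls_eval_def map_poly_pCons)

lemma fls_eval_const: "fls_eval \<xi> [:a:] = fls_const a"
  by (simp add: fls_eval_def map_poly_pCons)

text \<open>\<xi> is transcendental over K: p splits into linear factors, and none of them vanishes
  at a nonconstant series.\<close>

lemma fls_eval_nonzero:
  assumes \<xi>: "\<xi> \<notin> range fls_const" and "p \<noteq> 0"
  shows "fls_eval \<xi> p \<noteq> 0"
  using assms(2)
proof (induction "Polynomial.degree p" arbitrary: p rule: less_induct)
  case less
  show ?case
  proof (cases "Polynomial.degree p = 0")
    case True
    then obtain c where "p = [:c:]" by (meson degree_eq_zeroE)
    then show ?thesis using less by (simp add: fls_eval_const)
  next
    case False
    then obtain a where "poly p a = 0" using alg_closed_imp_poly_has_root by blast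
    then obtain q where q: "p = [:-a, 1:] * q" by (metis dvdE poly_eq_0_iff_dvd)
    then have "q \<noteq> 0" "Polynomial.degree q < Polynomial.degree p"
      using less.prems by (auto simp: degree_mult_eq simp del: mult_pCons_left)
    then have "fls_eval \<xi> q \<noteq> 0" using less.hyps by blast
    moreover have "fls_const (- a) + \<xi> \<noteq> 0"
      using \<xi> by (metis add_eq_0_iff fls_const_uminus minus_minus rangeI)
    ultimately show ?thesis by (simp add: q fls_eval_mult fls_eval_linear del: mult_pCons_left)
  qed
qed

lemma poly_valuation_fls_eval:
  assumes "\<xi> \<notin> range fls_const"
  shows "poly_valuation (\<lambda>p. fls_subdegree (fls_eval \<xi> p))"
proof
  fix p q :: "Qbar poly" assume "p \<noteq> 0" "q \<noteq> 0" "p + q \<noteq> 0"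
  then show "min (fls_subdegree (fls_eval \<xi> p)) (fls_subdegree (fls_eval \<xi> q))
      \<le> fls_subdegree (fls_eval \<xi> (p + q))"
    using fls_plus_subdegree fls_eval_nonzero[OF assms] by (metis fls_eval_add)
qed (use fls_eval_nonzero[OF assms] in \<open>simp_all add: fls_eval_mult fls_eval_const\<close>)

text \<open>Substituting x = \<xi>, y = Y embeds the function field in the Laurent series, and the
  order of the series is the place. The absolute value in \<open>unif\<close> admits a function with
  a simple pole, such as x at infinity; its inverse is then the uniformizer.\<close>

lemma place_from_parametrization:
  fixes \<xi> Y :: "Qbar fls"
  assumes \<xi>: "\<xi> \<notin> range fls_const"
    and Y: "Y\<^sup>2 + fls_eval \<xi> (base_change h) * Y = fls_eval \<xi> (base_change f)"
    and unif: "\<bar>fls_subdegree (fls_eval \<xi> a + fls_eval \<xi> b * Y)\<bar> = 1"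
  shows "\<exists>v\<in>places h f. \<forall>p. p \<noteq> 0 \<longrightarrow> v (poly_fun p) = fls_subdegree (fls_eval \<xi> p)"
proof -
  note nz = fls_eval_nonzero[OF \<xi>]
  define E where "E r = fls_eval \<xi> (fst (quot_of_fract r)) / fls_eval \<xi> (snd (quot_of_fract r))" for r
  have E: "E (to_fract p / to_fract q) = fls_eval \<xi> p / fls_eval \<xi> q" if "q \<noteq> 0" for p q
  proof -
    let ?r = "to_fract p / to_fract q"
    let ?p = "fst (quot_of_fract ?r)" and ?q = "snd (quot_of_fract ?r)"
    have "to_fract ?p / to_fract ?q = to_fract p / to_fract q"
      by (metis Fract_conv_to_fract Fract_quot_of_fract)
    then have "to_fract (?p * q) = to_fract (p * ?q)" using that by (simp add: field_simps)
    then have "?p * q = p * ?q" by (simp only: to_fract_eq_iff)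
    then have "fls_eval \<xi> ?p * fls_eval \<xi> q = fls_eval \<xi> p * fls_eval \<xi> ?q"
      by (metis fls_eval_mult)
    then show ?thesis unfolding E_def using nz that by (simp add: frac_eq_eq)
  qed
  have cases: "\<exists>p q. q \<noteq> 0 \<and> r = to_fract p / to_fract q" for r :: "Qbar poly fract"
    by (metis Fract_conv_to_fract Fract_quot_of_fract snd_quot_of_fract_nonzero)
  have Ep: "E (to_fract p) = fls_eval \<xi> p" for p
    by (simp add: E_def fls_eval_const flip: one_pCons) (metis fls_const_1 fls_eval_const one_pCons div_by_1)
  have E_mult: "E (r * s) = E r * E s" for r s
  proof -
    obtain p q where 1: "q \<noteq> 0" "r = to_fract p / to_fract q" using cases by blast
    obtain p' q' where 2: "q' \<noteq> 0" "s = to_fract p' / to_fract q'" using cases by blast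
    have "r * s = to_fract (p * p') / to_fract (q * q')" by (simp add: 1 2)
    then have "E (r * s) = fls_eval \<xi> (p * p') / fls_eval \<xi> (q * q')"
      using 1 2 E[of "q * q'" "p * p'"] by simp
    then show ?thesis using 1 2 by (simp add: E fls_eval_mult)
  qed
  have E_add: "E (r + s) = E r + E s" for r s
  proof -
    obtain p q where 1: "q \<noteq> 0" "r = to_fract p / to_fract q" using cases by blast
    obtain p' q' where 2: "q' \<noteq> 0" "s = to_fract p' / to_fract q'" using cases by blast
    have "r + s = to_fract (p * q' + p' * q) / to_fract (q * q')"
      using 1 2 by (simp add: add_frac_eq)
    then have "E (r + s) = fls_eval \<xi> (p * q' + p' * q) / fls_eval \<xi> (q * q')"
      using 1 2 E[of "q * q'"] by (metis mult_eq_0_iff)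
    then show ?thesis using 1 2 nz by (simp add: E fls_eval_mult fls_eval_add add_frac_eq)
  qed
  have E_eq_0: "E r = 0 \<longleftrightarrow> r = 0" for r
    using nz[of "fst (quot_of_fract r)"] nz[of "snd (quot_of_fract r)"]
    by (cases "r = 0") (simp_all add: E_def, simp add: fls_eval_def)
  have E0: "E 0 = 0" using E_eq_0 by blast
  define \<phi> where "\<phi> u = E (fst u) + E (snd u) * Y" for u
  have \<phi>_add: "\<phi> (u + w) = \<phi> u + \<phi> w" for u w by (simp add: \<phi>_def E_add algebra_simps)
  have E_minus: "E (- r) = - E r" for r
    using E_add[of r "- r"] E_eq_0[of 0] by (simp add: add_eq_0_iff)
  have \<phi>_mult: "\<phi> (u \<circledast> w) = \<phi> u * \<phi> w" for u w
  proof -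
    obtain a b c d where [simp]: "u = (a, b)" "w = (c, d)" by fastforce
    have YY: "Y * Y = E F - E H * Y" using Y by (simp add: Ep power2_eq_square algebra_simps)
    have "\<phi> u * \<phi> w = E a * E c + (E a * E d + E b * E c) * Y + E b * E d * (Y * Y)"
      by (simp add: \<phi>_def algebra_simps)
    also have "\<dots> = \<phi> (u \<circledast> w)"
      unfolding YY
      by (simp add: \<phi>_def fmult_eq E_add E_mult E_minus diff_conv_add_uminus del: add_uminus_conv_diff)
         (simp add: algebra_simps)
    finally show ?thesis ..
  qed
  \<comment> \<open>The norm reduces injectivity on the whole field to injectivity on K(x).\<close>
  have \<phi>_eq_0: "\<phi> u = 0 \<longleftrightarrow> u = 0" for u
  proof
    assume "\<phi> u = 0"
    then have "\<phi> (rat_fun (ff_norm u)) = 0" by (simp add: \<phi>_mult flip: fmult_ff_conj)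
    then show "u = 0" using E_eq_0 by (simp add: \<phi>_def E0)
  qed (simp add: \<phi>_def E0)
  define v where "v u = fls_subdegree (\<phi> u)" for u
  have v_poly: "v (poly_fun p) = fls_subdegree (fls_eval \<xi> p)" for p
    by (simp add: v_def \<phi>_def Ep E0)
  have v_mult: "v (u \<circledast> w) = v u + v w" if "u \<noteq> 0" "w \<noteq> 0" for u w
    using that by (simp add: v_def \<phi>_mult \<phi>_eq_0)
  have v_add: "min (v u) (v w) \<le> v (u + w)" if "u \<noteq> 0" "w \<noteq> 0" "u + w \<noteq> 0" for u w
    using that fls_plus_subdegree[of "\<phi> u" "\<phi> w"] \<phi>_eq_0[of "u + w"] by (simp add: v_def \<phi>_add)
  define t where "t = (to_fract a, to_fract b)"
  have t: "\<bar>v t\<bar> = 1" using unif by (simp add: t_def v_def \<phi>_def Ep)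
  have t0: "t \<noteq> 0" using t \<phi>_eq_0[of t] by (auto simp: v_def)
  have "\<exists>t. t \<noteq> 0 \<and> v t = 1"
  proof (cases "v t = 1")
    case False
    then have "v t = - 1" using t by linarith
    obtain s where s: "s \<noteq> 0" "t \<circledast> s = rat_fun 1" using inverse_exists[OF t0] by blast
    have "v (rat_fun 1) = 0"
      using v_poly[of 1] by (simp add: fls_eval_def)
    then show ?thesis using v_mult[OF t0 s(1)] s \<open>v t = - 1\<close> by (intro exI[of _ s]) simp
  qed (use t0 in blast)
  moreover have "v 0 = 0" by (simp add: v_def \<phi>_def E0)
  moreover have "v (ff_const c) = 0" for c
    using v_poly by (simp add: ff_const_def fls_eval_const)
  ultimately have "v \<in> places h f" unfolding places_def using v_mult v_add by blast
  then show ?thesis using v_poly by blast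
qed

text \<open>With S^2 = \<open>disc\<close>, the series Y = (S - h) / 2 solves the equation. The
  uniformizer is x + a or its inverse, or, at a branch point, 2 y + h = S of order 1.\<close>

lemma place_from_even_disc:
  fixes \<xi> :: "Qbar fls"
  assumes \<xi>: "\<xi> \<notin> range fls_const"
    and even: "even (fls_subdegree (fls_eval \<xi> disc))"
    and unif: "\<bar>fls_subdegree (fls_eval \<xi> [:a, 1:])\<bar> = 1 \<or> fls_subdegree (fls_eval \<xi> disc) = 2"
  shows "\<exists>v\<in>places h f. \<forall>p. p \<noteq> 0 \<longrightarrow> v (poly_fun p) = fls_subdegree (fls_eval \<xi> p)"
proof -
  obtain S where S: "S\<^sup>2 = fls_eval \<xi> disc" using fls_sqrt_exists[OF even] by blast
  let ?H = "fls_eval \<xi> (base_change h)" and ?F = "fls_eval \<xi> (base_change f)"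
  have four: "4 * base_change f = base_change f + base_change f + base_change f + base_change f" by simp
  have S': "S * S = ?H * ?H + 4 * ?F"
    using S unfolding disc_def four power2_eq_square fls_eval_add fls_eval_mult by simp
  define Y where "Y = (S - ?H) / 2"
  have Seq: "S = 2 * Y + ?H" by (simp add: Y_def del: right_diff_distrib_numeral)
  have zero: "z = 0" if "4 * z = 0" for z :: "Qbar fls" using that by simp
  have "Y\<^sup>2 + ?H * Y - ?F = 0"
    by (rule zero) (use S' in \<open>simp add: Seq power2_eq_square algebra_simps\<close>)
  then have Y: "Y\<^sup>2 + ?H * Y = ?F" by simp
  show ?thesis
  proof (cases "\<bar>fls_subdegree (fls_eval \<xi> [:a, 1:])\<bar> = 1")
    case True
    then show ?thesis
      using place_from_parametrization[OF \<xi> Y, of "[:a, 1:]" 0] by (simp add: fls_eval_def)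
  next
    case False
    have "fls_eval \<xi> (base_change h) + fls_eval \<xi> [:2:] * Y = S"
      by (simp add: Seq fls_eval_const)
    moreover have "2 * fls_subdegree S = 2"
      using S False unif by (metis fls_subdegree_pow of_nat_numeral)
    ultimately show ?thesis
      using place_from_parametrization[OF \<xi> Y, of "base_change h" "[:2:]"] by simp
  qed
qed

lemma infinite_place_exists: "\<exists>v\<in>places h f. v (poly_fun [:0, 1:]) < 0"
proof -
  \<comment> \<open>With x = 1/X the discriminant has the even order -6.\<close>
  let ?\<xi> = "fls_X_inv :: Qbar fls"
  have \<xi>: "?\<xi> \<notin> range fls_const"
    by (metis (no_types, lifting) fls_X_inv_subdegree fls_const_subdegree imageE neg_equal_0_iff_equal zero_neq_one)
  interpret poly_valuation "\<lambda>p. fls_subdegree (fls_eval ?\<xi> p)"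
    using poly_valuation_fls_eval[OF \<xi>] .
  have x: "fls_subdegree (fls_eval ?\<xi> [:0, 1:]) = - 1" by (simp add: fls_eval_linear)
  have "disc \<noteq> 0" using degree_disc by auto
  then have "fls_subdegree (fls_eval ?\<xi> disc) = - 6"
    using val_at_infinity[of disc] x by (simp add: degree_disc)
  then obtain v where v: "v \<in> places h f" "\<forall>p. p \<noteq> 0 \<longrightarrow> v (poly_fun p) = fls_subdegree (fls_eval ?\<xi> p)"
    using place_from_even_disc[OF \<xi>, of 0] x by auto
  then have "v (poly_fun [:0, 1:]) = - 1" using x by (metis pCons_eq_0_iff one_neq_zero)
  then show ?thesis using v(1) by (intro bexI[of _ v]) auto
qed

lemma finite_place_exists: "\<exists>v\<in>places h f. v (poly_fun [:-c, 1:]) > 0"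
proof -
  \<comment> \<open>At a branch point \<open>disc\<close> has a simple zero, so x - c = X^2 is taken
    to make its order even; elsewhere x - c = X is a uniformizer.\<close>
  define k :: nat where "k = (if poly disc c = 0 then 2 else 1)"
  define \<xi> :: "Qbar fls" where "\<xi> = fls_const c + fls_X ^ k"
  have lin: "fls_eval \<xi> [:-c, 1:] = fls_X ^ k"
    by (simp add: fls_eval_linear \<xi>_def fls_plus_const flip: add.assoc)
  have k: "k > 0" by (simp add: k_def)
  have \<xi>: "\<xi> \<notin> range fls_const"
  proof
    assume "\<xi> \<in> range fls_const"
    then obtain e where "\<xi> = fls_const e" by blast
    then have "fls_X ^ k = fls_const (e - c)" by (simp add: \<xi>_def fls_minus_const[symmetric] algebra_simps)
    then have "fls_subdegree (fls_X ^ k :: Qbar fls) = 0" by simp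
    then show False using k by simp
  qed
  interpret poly_valuation "\<lambda>p. fls_subdegree (fls_eval \<xi> p)"
    using poly_valuation_fls_eval[OF \<xi>] .
  have disc0: "disc \<noteq> 0" using degree_disc by auto
  have d: "fls_subdegree (fls_eval \<xi> disc) = int (Polynomial.order c disc) * int k"
    using val_at_point[of c disc] disc0 k by (simp add: lin)
  have "Polynomial.order c disc = (if poly disc c = 0 then 1 else 0)"
  proof -
    have "\<not> [:-c, 1:] ^ 2 dvd disc"
      using squarefree_poly_square_dvd[OF squarefree_disc, of "[:-c, 1:]"] by auto
    then have "Polynomial.order c disc < 2" using order_divides[of c 2 disc] disc0 by auto
    moreover have "poly disc c = 0 \<longleftrightarrow> Polynomial.order c disc \<noteq> 0" using order_root disc0 by blast
    ultimately show ?thesis by auto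
  qed
  then have "fls_subdegree (fls_eval \<xi> disc) = (if poly disc c = 0 then 2 else 0)"
    using d by (simp add: k_def)
  then have "\<exists>v\<in>places h f. \<forall>p. p \<noteq> 0 \<longrightarrow> v (poly_fun p) = fls_subdegree (fls_eval \<xi> p)"
    using lin by (intro place_from_even_disc[OF \<xi>, of "-c"]) (auto simp: k_def)
  then obtain v where v: "v \<in> places h f" "\<forall>p. p \<noteq> 0 \<longrightarrow> v (poly_fun p) = fls_subdegree (fls_eval \<xi> p)"
    by blast
  then have "v (poly_fun [:-c, 1:]) = int k"
    using lin by (metis fls_subdegree_fls_X_pow pCons_eq_0_iff one_neq_zero)
  then show ?thesis using v(1) k by (intro bexI[of _ v]) auto
qed

subsection \<open>The infinite places\<close>

abbreviation x_fun :: function_field where "x_fun \<equiv> poly_fun [:0, 1:]"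

lemma place_poly_infinite:
  "v \<in> places h f \<Longrightarrow> v x_fun < 0 \<Longrightarrow> p \<noteq> 0 \<Longrightarrow>
    v (poly_fun p) = int (Polynomial.degree p) * v x_fun"
  using poly_valuation.val_at_infinity[OF poly_valuation_place] by blast

lemma place_poly_point:
  "v \<in> places h f \<Longrightarrow> v (poly_fun [:-c, 1:]) > 0 \<Longrightarrow> p \<noteq> 0 \<Longrightarrow>
    v (poly_fun p) = int (Polynomial.order c p) * v (poly_fun [:-c, 1:])"
  using poly_valuation.val_at_point[OF poly_valuation_place] by blast

lemma place_poly_finite:
  "v \<in> places h f \<Longrightarrow> v x_fun \<ge> 0 \<Longrightarrow> p \<noteq> 0 \<Longrightarrow> v (poly_fun p) \<ge> 0"
  using poly_valuation.val_nonneg[OF poly_valuation_place] by blast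

lemma place_point_finite:
  assumes "v \<in> places h f" "v (poly_fun [:-c, 1:]) > 0"
  shows "v x_fun \<ge> 0"
proof (rule ccontr)
  assume "\<not> v x_fun \<ge> 0"
  then show False using place_poly_infinite[OF assms(1), of "[:-c, 1:]"] assms(2) by simp
qed

text \<open>The branch at infinity on which y is close to f/h rather than to - h. Only values of x
  and y enter, so the condition is Galois-invariant.\<close>

definition at_plus :: "(function_field \<Rightarrow> int) \<Rightarrow> bool" where
  "at_plus v \<longleftrightarrow> v \<in> places h f \<and> v x_fun < 0 \<and> 3 * v x_fun < v y_fun"

lemma base_change_h_nonzero: "base_change h \<noteq> 0"
  using deg_h by auto

lemma place_infinite_h: "v \<in> places h f \<Longrightarrow> v x_fun < 0 \<Longrightarrow> v (rat_fun H) = 3 * v x_fun"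
  using place_poly_infinite[of v "base_change h"] base_change_h_nonzero deg_h by simp

lemma place_infinite_f: "v \<in> places h f \<Longrightarrow> v x_fun < 0 \<Longrightarrow> v (rat_fun F) \<ge> 3 * v x_fun"
  using place_poly_infinite[of v "base_change f"] f_nonzero deg_f
  by (simp add: mult_le_cancel_right)

lemma place_y_conj:
  assumes "v \<in> places h f"
  shows "v y_fun + v (ff_conj y_fun) = v (rat_fun F)"
proof -
  have "ff_norm y_fun = - F" by (simp add: ff_norm_def)
  then have "v y_fun + v (ff_conj y_fun) = v (- rat_fun F)"
    using place_norm[OF assms, of y_fun] by (simp add: zero_prod_def)
  then show ?thesis using place_minus[OF assms, of "rat_fun F"] by simp
qed

text \<open>The product of y and its conjugate is - f, and v f >= 3 v x. So if v y <= 3 v x, the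
  conjugate of y has value at least 0.\<close>

lemma at_plus_cases:
  assumes v: "v \<in> places h f" "v x_fun < 0"
  shows "at_plus v \<or> at_plus (\<lambda>u. v (ff_conj u))"
proof (cases "3 * v x_fun < v y_fun")
  case False
  then show ?thesis
    using v place_y_conj[OF v(1)] place_infinite_f[OF v] place_conj[OF v(1)]
    unfolding at_plus_def by auto
qed (use v in \<open>auto simp: at_plus_def\<close>)

text \<open>The iteration with \<rho> = 0, so h' = h, f' = f and \<eta> = y; it converges since 2 v
  h = 6 v x < 3 v x <= v f. Values on K(x) are degree differences times v (1/x).\<close>

lemma at_plus_unique:
  shows "at_plus v \<Longrightarrow> v x_fun = - 1" and "at_plus v \<Longrightarrow> at_plus v' \<Longrightarrow> v = v'"
proof -
  let ?S = "{v. at_plus v}"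
  let ?w = "\<lambda>r. int (Polynomial.degree (snd (quot_of_fract r))) - int (Polynomial.degree (fst (quot_of_fract r)))"
  let ?z = "1 / to_fract [:0, 1:] :: Qbar poly fract"
  have z: "v (rat_fun ?z) = - v x_fun" if "at_plus v" for v
  proof -
    have v: "v \<in> places h f" using that by (simp add: at_plus_def)
    have "rat_fun ?z \<circledast> x_fun = rat_fun 1" by (simp add: rat_fun_mult)
    then have "v (rat_fun ?z) + v x_fun = v (rat_fun 1)"
      using place_mult[OF v, of "rat_fun ?z" x_fun] by simp
    then show ?thesis using place_one[OF v] by simp
  qed
  have *: "v (rat_fun ?z) = 1 \<and> v = v'" if "at_plus v" "at_plus v'" for v v'
  proof -
    have "v (rat_fun (H + 2 * 0)) < v (- 0, 1) \<and>
        2 * v (rat_fun (H + 2 * 0)) < v (rat_fun (F - H * 0 - 0\<^sup>2))" if "v \<in> ?S" for v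
      using that place_infinite_h[of v] place_infinite_f[of v] by (auto simp: at_plus_def)
    moreover have "v (rat_fun r) = v (rat_fun ?z) * ?w r" if "v \<in> ?S" "r \<noteq> 0" for v r
    proof -
      obtain p q where pq: "quot_of_fract r = (p, q)" by fastforce
      have v: "v \<in> places h f" "v x_fun < 0" "at_plus v" using that by (auto simp: at_plus_def)
      note rf = place_rat_fun[OF v(1) that(2) pq]
      show ?thesis
        using rf(3) place_poly_infinite[OF v(1,2) rf(1)] place_poly_infinite[OF v(1,2) rf(2)] z[OF v(3)]
        by (simp add: pq algebra_simps)
    qed
    moreover have "v (rat_fun ?z) > 0" if "v \<in> ?S" for v
      using that z[of v] by (auto simp: at_plus_def)
    moreover have "H + 2 * 0 \<noteq> 0" using base_change_h_nonzero by simp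
    moreover have "?S \<subseteq> places h f" by (auto simp: at_plus_def)
    ultimately show ?thesis
      using places_determined_by_restriction[of ?S 0 ?z ?w] that by blast
  qed
  show "at_plus v \<Longrightarrow> v x_fun = - 1" using *[of v v] z[of v] by simp
  show "at_plus v \<Longrightarrow> at_plus v' \<Longrightarrow> v = v'" using *[of v v'] by blast
qed

lemma at_plus_exists: "\<exists>v. at_plus v"
  using infinite_place_exists at_plus_cases by blast

definition plus_place :: "function_field \<Rightarrow> int" where "plus_place = (THE v. at_plus v)"

text \<open>Here y behaves like - h and has a pole of order 3.\<close>

definition minus_place :: "function_field \<Rightarrow> int" where "minus_place u = plus_place (ff_conj u)"

lemma at_plus_plus_place: "at_plus plus_place"
proof -
  obtain v where v: "at_plus v" using at_plus_exists by blast
  then have "(THE v. at_plus v) = v" using at_plus_unique(2) by (intro the_equality) blast+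
  then show ?thesis using v by (simp add: plus_place_def)
qed

lemma at_plus_iff: "at_plus v \<longleftrightarrow> v = plus_place"
  using at_plus_plus_place at_plus_unique(2) by blast

lemma plus_place: "plus_place \<in> places h f" "plus_place x_fun = - 1" "plus_place y_fun > - 3"
  using at_plus_plus_place at_plus_unique(1)[OF at_plus_plus_place] by (auto simp: at_plus_def)

lemma minus_place: "minus_place \<in> places h f" "minus_place x_fun = - 1"
  using place_conj[OF plus_place(1)] plus_place(2) by (simp_all add: minus_place_def[abs_def])

lemma infinite_place_cases:
  assumes "v \<in> places h f" "v x_fun < 0"
  shows "v = plus_place \<or> v = minus_place"
proof -
  have "v = minus_place" if "(\<lambda>u. v (ff_conj u)) = plus_place"
    using that unfolding minus_place_def[abs_def] by (metis ff_conj_conj)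
  then show ?thesis using at_plus_cases[OF assms] by (auto simp: at_plus_iff)
qed

lemma plus_place_poly: "p \<noteq> 0 \<Longrightarrow> plus_place (poly_fun p) = - int (Polynomial.degree p)"
  using place_poly_infinite[OF plus_place(1)] plus_place(2) by simp

text \<open>At \<open>minus_place\<close>, a + b y has the value that its conjugate (a - b h) - b y
  has at \<open>plus_place\<close>. There y has a pole of order at most 2, so deg b + 2 < n makes a
  - b h dominate.\<close>

lemma minus_place_value:
  assumes n: "Polynomial.degree (a - b * base_change h) = n" "Polynomial.degree b + 2 < n"
  shows "(to_fract a, to_fract b) \<noteq> 0" "minus_place (to_fract a, to_fract b) = - int n"
proof -
  let ?p = "a - b * base_change h"
  have conj: "ff_conj (to_fract a, to_fract b) = poly_fun ?p + poly_fun (- b) \<circledast> y_fun"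
    by (simp add: ff_conj_def fmult_eq)
  have p0: "?p \<noteq> 0" using n by auto
  have p: "plus_place (poly_fun ?p) = - int n" using plus_place_poly[OF p0] n by simp
  have b: "poly_fun (- b) \<circledast> y_fun = 0 \<or>
      plus_place (poly_fun ?p) < plus_place (poly_fun (- b) \<circledast> y_fun)"
  proof (cases "b = 0")
    case False
    have "plus_place (poly_fun (- b) \<circledast> y_fun) = plus_place (poly_fun (- b)) + plus_place y_fun"
      using False by (intro place_mult plus_place) (simp_all add: zero_prod_def)
    then show ?thesis using p plus_place(3) plus_place_poly[of "- b"] False n by auto
  qed (simp add: fmult_eq zero_prod_def)
  have r: "poly_fun ?p \<noteq> 0" using p0 by (simp only: rat_fun_eq_0_iff to_fract_eq_0_iff) simp
  have "ff_conj (to_fract a, to_fract b) \<noteq> 0 \<and>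
      plus_place (ff_conj (to_fract a, to_fract b)) = plus_place (poly_fun ?p)"
    unfolding conj using place_add_dominant[OF plus_place(1) r b] by simp
  then show "(to_fract a, to_fract b) \<noteq> 0" "minus_place (to_fract a, to_fract b) = - int n"
    using p by (simp_all add: minus_place_def)
qed

lemma plus_minus_norm:
  assumes "u \<noteq> 0" "ff_norm u = to_fract w"
  shows "plus_place u + minus_place u = - int (Polynomial.degree w)"
proof -
  have "w \<noteq> 0" using assms ff_norm_eq_0_iff by (metis to_fract_0)
  then show ?thesis
    using place_norm[OF plus_place(1) assms(1)] assms(2) plus_place_poly
    by (simp add: minus_place_def)
qed

lemma plus_neq_minus: "plus_place \<noteq> minus_place"
proof
  assume eq: "plus_place = minus_place"
  have "minus_place (to_fract 0, to_fract 1) = - 3"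
    using minus_place_value(2)[of 0 1 3] by (simp add: deg_h)
  then show False using eq plus_place(3) by simp
qed

subsection \<open>Finite places\<close>

text \<open>Integrality of y: if y had a pole, y + h would have the same one, but y (y + h) = f is
  regular.\<close>

lemma finite_place_y:
  assumes v: "v \<in> places h f" "v x_fun \<ge> 0"
  shows "v y_fun \<ge> 0"
proof (rule ccontr)
  assume neg: "\<not> v y_fun \<ge> 0"
  have H0: "v (rat_fun H) \<ge> 0"
    using place_poly_finite[OF v] base_change_h_nonzero by blast
  have "ff_conj y_fun = - (y_fun + rat_fun H)" by (simp add: ff_conj_def)
  then have "v (ff_conj y_fun) = v (y_fun + rat_fun H)"
    using place_minus[OF v(1), of "y_fun + rat_fun H"] by simp
  also have "\<dots> = v y_fun"
    using neg H0 by (intro place_add_dominant[OF v(1)]) (auto simp: zero_prod_def)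
  finally have "v (rat_fun F) < 0" using place_y_conj[OF v(1)] neg by simp
  moreover have "v (rat_fun F) \<ge> 0" using place_poly_finite[OF v] f_nonzero by simp
  ultimately show False by simp
qed

lemma finite_place_nonneg:
  assumes v: "v \<in> places h f" "v x_fun \<ge> 0" and u: "(to_fract a, to_fract b) \<noteq> 0"
  shows "v (to_fract a, to_fract b) \<ge> 0"
proof -
  have eq: "(to_fract a, to_fract b) = poly_fun a + poly_fun b \<circledast> y_fun" by (simp add: fmult_eq)
  show ?thesis
  proof (cases "b = 0")
    case True
    then show ?thesis using place_poly_finite[OF v, of a] u by auto
  next
    case b: False
    have y: "v (poly_fun b \<circledast> y_fun) \<ge> 0" "poly_fun b \<circledast> y_fun \<noteq> 0"
      using place_mult[OF v(1), of "poly_fun b" y_fun] place_poly_finite[OF v b] finite_place_y[OF v] b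
      by (auto simp: zero_prod_def fmult_eq)
    show ?thesis
    proof (cases "a = 0")
      case True
      then show ?thesis using y by (simp add: fmult_eq)
    next
      case False
      then show ?thesis
        using place_add[OF v(1), of "poly_fun a" "poly_fun b \<circledast> y_fun"] y u
          place_poly_finite[OF v False] by (simp flip: eq)
    qed
  qed
qed

lemma ff_norm_poly:
  "ff_norm (to_fract a, to_fract b) = to_fract (a\<^sup>2 - a * b * base_change h - b\<^sup>2 * base_change f)"
  by (simp add: ff_norm_def power2_eq_square)

lemma ff_conj_poly: "ff_conj (to_fract a, to_fract b) = (to_fract (a - b * base_change h), to_fract (- b))"
  by (simp add: ff_conj_def)

text \<open>Both u and its conjugate are regular, so if their product is a unit, so is each of
  them.\<close>

lemma finite_place_unit:
  assumes v: "v \<in> places h f" "v x_fun \<ge> 0" and u: "u = (to_fract a, to_fract b)" "u \<noteq> 0"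
    and n: "v (rat_fun (ff_norm u)) = 0"
  shows "v u = 0"
proof -
  have "v u \<ge> 0" using finite_place_nonneg[OF v] u by simp
  moreover have "v (ff_conj u) \<ge> 0"
    using finite_place_nonneg[OF v, of "a - b * base_change h" "- b"] u ff_conj_eq_0_iff[of u]
    unfolding u(1) ff_conj_poly by blast
  ultimately show ?thesis using place_norm[OF v(1) u(2)] n by simp
qed

text \<open>A root c of the denominator is not a root of the numerator, so r would have a pole at
  the place above c that \<open>finite_place_exists\<close> provides.\<close>

lemma rational_function_is_polynomial:
  assumes "\<And>v. v \<in> places h f \<Longrightarrow> v x_fun \<ge> 0 \<Longrightarrow> v (rat_fun r) \<ge> 0" and r: "r \<noteq> 0"
  shows "\<exists>w. r = to_fract w"
proof -
  obtain p q where pq: "quot_of_fract r = (p, q)" by fastforce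
  have cop: "coprime p q" using coprime_quot_of_fract[of r] pq by simp
  have "Polynomial.degree q = 0"
  proof (rule ccontr)
    assume "Polynomial.degree q \<noteq> 0"
    then obtain c where c: "poly q c = 0" using alg_closed_imp_poly_has_root by blast
    then have pc: "poly p c \<noteq> 0" using cop coprime_poly_0 by blast
    obtain v where v: "v \<in> places h f" "v (poly_fun [:-c, 1:]) > 0"
      using finite_place_exists by blast
    note rf = place_rat_fun[OF v(1) r pq]
    have "v (poly_fun p) = 0"
      using place_poly_point[OF v rf(1)] order_root[of p c] pc by simp
    moreover have "v (poly_fun q) > 0"
      using place_poly_point[OF v rf(2)] order_root[of q c] c rf(2) v(2) by simp
    ultimately show False
      using assms(1)[OF v(1) place_point_finite[OF v]] rf(3) by simp
  qed
  then obtain c where c: "q = [:c:]" by (meson degree_eq_zeroE)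
  have q0: "q \<noteq> 0" using snd_quot_of_fract_nonzero[of r] pq by simp
  then have "to_fract p = to_fract (smult (inverse c) p) * to_fract q"
    using c by (simp flip: to_fract_mult)
  moreover have "r = to_fract p / to_fract q"
    using Fract_quot_of_fract[of r] pq by (simp add: Fract_conv_to_fract)
  ultimately show ?thesis using q0 by (metis nonzero_eq_divide_eq to_fract_eq_0_iff)
qed

text \<open>
  If \<open>g = a + b y\<close> has no finite poles, then \<open>(g - conj g)\<^sup>2 = b\<^sup>2 (h\<^sup>2 + 4 f)\<close> is a polynomial, and
  poles of order at most 2 at infinity bound its degree by 4. As \<open>h\<^sup>2 + 4 f\<close> is squarefree of
  degree 6, this forces \<open>b = 0\<close>.
\<close>

lemma small_poles_imp_symmetric:
  assumes g: "g \<noteq> 0" and fin: "\<And>v. v \<in> places h f \<Longrightarrow> v x_fun \<ge> 0 \<Longrightarrow> v g \<ge> 0"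
    and inf: "plus_place g \<ge> - 2" "minus_place g \<ge> - 2"
  shows "plus_place g = minus_place g"
proof (cases "snd g = 0")
  case True
  then have "ff_conj g = g" by (cases g) simp
  then show ?thesis by (simp add: minus_place_def)
next
  case False
  define k where "k = g + - ff_conj g"
  define r where "r = (snd g)\<^sup>2 * to_fract disc"
  have k: "k = (snd g * H, 2 * snd g)"
    by (cases g) (simp add: k_def ff_conj_def)
  have k0: "k \<noteq> 0" using False base_change_h_nonzero by (simp add: k zero_prod_def)
  have kk: "k \<circledast> k = rat_fun r"
    by (simp add: k fmult_eq r_def to_fract_disc power2_eq_square algebra_simps)
  have r0: "r \<noteq> 0" using kk k0 fmult_eq_0_iff rat_fun_eq_0_iff by metis
  have ge: "v (rat_fun r) \<ge> 2 * m" if v: "v \<in> places h f" and m: "v g \<ge> m" "v (ff_conj g) \<ge> m" for v m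
  proof -
    have cg: "- ff_conj g \<noteq> 0" using g by (metis ff_conj_eq_0_iff neg_equal_0_iff_equal)
    have "v k \<ge> m"
      using place_add[OF v g cg] k0 m place_minus[OF v, of "ff_conj g"] unfolding k_def by simp
    then show ?thesis using place_mult[OF v k0 k0] kk by simp
  qed
  have "v (rat_fun r) \<ge> 0" if v: "v \<in> places h f" "v x_fun \<ge> 0" for v
  proof -
    have "v (ff_conj g) \<ge> 0" using fin[OF place_conj[OF v(1)]] v(2) by simp
    then show ?thesis using ge[OF v(1), of 0] fin[OF v] by simp
  qed
  then obtain w where w: "r = to_fract w" using rational_function_is_polynomial[OF _ r0] by blast
  have w0: "w \<noteq> 0" using w r0 by auto
  \<comment> \<open>The value of \<open>ff_conj g\<close> at \<open>plus_place\<close> is that of g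
    at \<open>minus_place\<close>, so both pole bounds enter.\<close>
  have "plus_place (rat_fun r) \<ge> - 4"
    using ge[OF plus_place(1), of "- 2"] inf by (simp add: minus_place_def)
  then have deg: "Polynomial.degree w \<le> 4" using plus_place_poly[OF w0] w by simp
  obtain p where p: "snd g = to_fract p" using square_times_disc_poly w unfolding r_def by blast
  then have "to_fract (p\<^sup>2 * disc) = to_fract w" using w by (simp add: r_def power2_eq_square)
  then have "w = p\<^sup>2 * disc" by (simp only: to_fract_eq_iff)
  moreover have "p \<noteq> 0" using p False by auto
  moreover have "disc \<noteq> 0" using degree_disc by auto
  ultimately have "Polynomial.degree w \<ge> 6"
    by (simp add: degree_mult_eq degree_disc)
  then show ?thesis using deg by simp
qed

subsection \<open>Unramified finite points\<close>

definition at_point :: "Qbar \<Rightarrow> Qbar \<Rightarrow> (function_field \<Rightarrow> int) \<Rightarrow> bool" where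
  "at_point c e v \<longleftrightarrow> v \<in> places h f \<and> v (poly_fun [:-c, 1:]) > 0 \<and> v (to_fract [:-e:], 1) > 0"

lemma at_point_norm:
  "ff_norm (to_fract [:-e:], 1) = - to_fract (base_change f - smult e (base_change h) - [:e\<^sup>2:])"
proof -
  have "ff_norm (to_fract [:-e:], to_fract 1)
      = to_fract (- (base_change f - smult e (base_change h) - [:e\<^sup>2:]))"
    unfolding ff_norm_poly to_fract_eq_iff by (simp add: power2_eq_square)
  then show ?thesis by simp
qed

text \<open>Some place lies above c. There the norm of y - e vanishes, so y - e or its conjugate
  does; in the second case the conjugate place is taken.\<close>

lemma at_point_exists:
  assumes "e\<^sup>2 + poly (base_change h) c * e = poly (base_change f) c"
  shows "\<exists>v. at_point c e v"
proof -
  let ?\<eta> = "(to_fract [:-e:], 1) :: function_field"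
  let ?w = "base_change f - smult e (base_change h) - [:e\<^sup>2:]"
  have \<eta>0: "?\<eta> \<noteq> 0" by (simp add: zero_prod_def)
  have w0: "?w \<noteq> 0" using \<eta>0 at_point_norm[of e] ff_norm_eq_0_iff[of ?\<eta>] by (metis minus_zero to_fract_0)
  obtain v where v: "v \<in> places h f" "v (poly_fun [:-c, 1:]) > 0"
    using finite_place_exists by blast
  have "poly ?w c = 0" using assms by (simp add: algebra_simps)
  then have "v (poly_fun ?w) > 0"
    using place_poly_point[OF v w0] order_root[of ?w c] w0 v(2) by simp
  then have "v (rat_fun (ff_norm ?\<eta>)) > 0"
    using place_minus[OF v(1), of "poly_fun ?w"] unfolding at_point_norm by simp
  then have "v ?\<eta> > 0 \<or> v (ff_conj ?\<eta>) > 0" using place_norm[OF v(1) \<eta>0] by linarith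
  then have "at_point c e v \<or> at_point c e (\<lambda>u. v (ff_conj u))"
    using v place_conj[OF v(1)] by (auto simp: at_point_def)
  then show ?thesis by blast
qed

text \<open>The iteration with \<rho> = e: h' = h + 2 e is a unit at c by \<open>unramified\<close>,
  while f' = f - e h - e^2 vanishes there. For the last claim, the conjugate of y - e is - (h' + (y
  - e)), again a unit.\<close>

lemma at_point_unique:
  assumes on: "e\<^sup>2 + poly (base_change h) c * e = poly (base_change f) c"
    and unramified: "poly (base_change h) c + 2 * e \<noteq> 0"
  shows "at_point c e v \<Longrightarrow> v (poly_fun [:-c, 1:]) = 1"
    and "at_point c e v \<Longrightarrow> at_point c e v' \<Longrightarrow> v = v'"
    and "at_point c e v \<Longrightarrow> v (rat_fun (ff_norm (to_fract [:-e:], 1))) = v (to_fract [:-e:], 1)"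
proof -
  let ?S = "{v. at_point c e v}"
  let ?w = "\<lambda>r. int (Polynomial.order c (fst (quot_of_fract r))) - int (Polynomial.order c (snd (quot_of_fract r)))"
  let ?z = "to_fract [:-c, 1:] :: Qbar poly fract"
  let ?\<eta> = "(to_fract [:-e:], 1) :: function_field"
  let ?f = "base_change f - smult e (base_change h) - [:e\<^sup>2:]"
  let ?h = "base_change h + [:2 * e:]"
  have hE: "H + 2 * to_fract [:e:] = to_fract ?h"
  proof -
    have "[:2 * e:] = [:e:] + [:e:]" by simp
    then show ?thesis by (simp only: to_fract_add) simp
  qed
  have "?f = base_change f - base_change h * [:e:] - [:e:]\<^sup>2"
    by (simp add: power2_eq_square)
  then have fE: "F - H * to_fract [:e:] - (to_fract [:e:])\<^sup>2 = to_fract ?f"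
    by (simp only: to_fract_diff to_fract_mult power2_eq_square)
  have \<eta>E: "(- to_fract [:e:], 1) = ?\<eta>" by (simp flip: to_fract_uminus)
  have hc: "poly ?h c \<noteq> 0" using unramified by simp
  have h0: "?h \<noteq> 0" using hc by (metis poly_0)
  have \<eta>0: "?\<eta> \<noteq> 0" by (simp add: zero_prod_def)
  have f0: "?f \<noteq> 0" using \<eta>0 at_point_norm[of e] ff_norm_eq_0_iff[of ?\<eta>] by (metis minus_zero to_fract_0)
  have fc: "poly ?f c = 0" using on by (simp add: algebra_simps)
  have vh: "v (poly_fun ?h) = 0" if "at_point c e v" for v
    using place_poly_point[of v c ?h] that h0 hc order_root[of ?h c] by (simp add: at_point_def)
  have small: "v (rat_fun (H + 2 * to_fract [:e:])) < v (- to_fract [:e:], 1) \<and>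
      2 * v (rat_fun (H + 2 * to_fract [:e:])) < v (rat_fun (F - H * to_fract [:e:] - (to_fract [:e:])\<^sup>2))"
    if "v \<in> ?S" for v
  proof -
    have "v (poly_fun ?f) > 0"
      using place_poly_point[of v c ?f] that f0 fc order_root[of ?f c] by (simp add: at_point_def)
    then show ?thesis unfolding hE fE \<eta>E using that vh[of v] by (simp add: at_point_def)
  qed
  have w: "v (rat_fun r) = v (rat_fun ?z) * ?w r" if "v \<in> ?S" "r \<noteq> 0" for v r
  proof -
    obtain p q where pq: "quot_of_fract r = (p, q)" by fastforce
    have v: "v \<in> places h f" "v (poly_fun [:-c, 1:]) > 0" using that by (auto simp: at_point_def)
    note rf = place_rat_fun[OF v(1) that(2) pq]
    show ?thesis
      using rf(3) place_poly_point[OF v rf(1)] place_poly_point[OF v rf(2)]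
      by (simp add: pq algebra_simps)
  qed
  have z: "v (rat_fun ?z) > 0" if "v \<in> ?S" for v
    using that by (simp add: at_point_def)
  have S: "?S \<subseteq> places h f" by (auto simp: at_point_def)
  have h0': "H + 2 * to_fract [:e:] \<noteq> 0" unfolding hE to_fract_eq_0_iff by (rule h0)
  note det = places_determined_by_restriction[where S = ?S and \<rho> = "to_fract [:e:]" and z = ?z and w = ?w]
  show "v (poly_fun [:-c, 1:]) = 1" if "at_point c e v"
    by (rule det(1)) (fact S h0' small w z | use that in simp)+
  show "v = v'" if "at_point c e v" "at_point c e v'"
    by (rule det(2)) (fact S h0' small w z | use that in simp)+
  assume v: "at_point c e v"
  then have vp: "v \<in> places h f" and pos: "v ?\<eta> > 0" by (auto simp: at_point_def)
  have "ff_conj ?\<eta> = - (poly_fun ?h + ?\<eta>)"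
    unfolding hE[symmetric] \<eta>E[symmetric] by (simp add: ff_conj_def)
  then have "v (ff_conj ?\<eta>) = v (poly_fun ?h + ?\<eta>)"
    using place_minus[OF vp, of "poly_fun ?h + ?\<eta>"] by simp
  also have "\<dots> = v (poly_fun ?h)"
  proof (intro place_add_dominant[OF vp])
    show "poly_fun ?h \<noteq> 0" unfolding rat_fun_eq_0_iff to_fract_eq_0_iff by (rule h0)
    show "?\<eta> = 0 \<or> v (poly_fun ?h) < v ?\<eta>" unfolding vh[OF v] using pos by simp
  qed
  finally show "v (rat_fun (ff_norm ?\<eta>)) = v ?\<eta>"
    using place_norm[OF vp \<eta>0] unfolding vh[OF v] by simp
qed

end

section \<open>The divisor class group\<close>

lemma deg_divisor_superset:
  assumes "finite A" "Poly_Mapping.keys D \<subseteq> A"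
  shows "deg_divisor D = (\<Sum>P\<in>A. Poly_Mapping.lookup D P)"
  unfolding deg_divisor_def using assms
  by (intro sum.mono_neutral_left) (auto simp: in_keys_iff)

lemma deg_divisor_add: "deg_divisor (D + E) = deg_divisor D + deg_divisor E"
proof -
  let ?A = "Poly_Mapping.keys D \<union> Poly_Mapping.keys E"
  have "finite ?A" by simp
  moreover have "Poly_Mapping.keys (D + E) \<subseteq> ?A" by (rule keys_add)
  ultimately show ?thesis
    by (simp add: deg_divisor_superset[of ?A] lookup_add sum.distrib)
qed

lemma deg_divisor_0 [simp]: "deg_divisor 0 = 0"
  by (simp add: deg_divisor_def)

lemma deg_divisor_minus: "deg_divisor (- D) = - deg_divisor D"
  using deg_divisor_add[of D "- D"] by simp

lemma deg_divisor_diff: "deg_divisor (D - E) = deg_divisor D - deg_divisor E"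
  using deg_divisor_add[of D "- E"] by (simp add: deg_divisor_minus)

lemma deg_divisor_frag_of [simp]: "deg_divisor (frag_of P) = 1"
  by (simp add: deg_divisor_def)

lemma divisors_deg0_iff:
  "D \<in> divisors_deg0 h f \<longleftrightarrow> Poly_Mapping.keys D \<subseteq> places h f \<and> deg_divisor D = 0"
  by (simp add: divisors_deg0_def)

lemma divisors_deg0_add: "D \<in> divisors_deg0 h f \<Longrightarrow> E \<in> divisors_deg0 h f \<Longrightarrow> D + E \<in> divisors_deg0 h f"
  using keys_add[of D E] by (auto simp: divisors_deg0_iff deg_divisor_add)

lemma divisors_deg0_minus: "D \<in> divisors_deg0 h f \<Longrightarrow> - D \<in> divisors_deg0 h f"
  by (simp add: divisors_deg0_iff deg_divisor_minus keys_minus)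

lemma divisors_deg0_zero: "0 \<in> divisors_deg0 h f"
  by (simp add: divisors_deg0_iff)

abbreviation deg0_group :: "rat poly \<Rightarrow> rat poly \<Rightarrow> divisor monoid" where
  "deg0_group h f \<equiv> (free_Abelian_group (places h f))\<lparr>carrier := divisors_deg0 h f\<rparr>"

lemma comm_group_deg0: "comm_group (deg0_group h f)"
proof (rule comm_groupI)
  show "\<exists>y\<in>carrier (deg0_group h f). y \<otimes>\<^bsub>deg0_group h f\<^esub> x = \<one>\<^bsub>deg0_group h f\<^esub>"
    if "x \<in> carrier (deg0_group h f)" for x
    using that divisors_deg0_minus[of x] by (intro bexI[of _ "- x"]) (simp_all add: free_Abelian_group_def)
qed (auto simp: free_Abelian_group_def divisors_deg0_add divisors_deg0_zero add_ac)

lemma deg0_group_simps [simp]: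
  "carrier (deg0_group h f) = divisors_deg0 h f"
  "x \<otimes>\<^bsub>deg0_group h f\<^esub> y = x + y" "\<one>\<^bsub>deg0_group h f\<^esub> = 0"
  by (simp_all add: free_Abelian_group_def)

lemma deg0_group_inv:
  assumes "x \<in> divisors_deg0 h f"
  shows "inv\<^bsub>deg0_group h f\<^esub> x = - x"
proof -
  interpret comm_group "deg0_group h f" by (rule comm_group_deg0)
  show ?thesis using assms divisors_deg0_minus[OF assms] by (intro inv_equality) simp_all
qed

lemma deg0_group_pow: "x [^]\<^bsub>deg0_group h f\<^esub> (n::nat) = frag_cmul (int n) x"
  by (induction n) (simp_all add: nat_pow_def frag_cmul_distrib add.commute free_Abelian_group_def)

lemma jacobian_eq: "jacobian h f = deg0_group h f Mod principal_divisors h f"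
  by (simp add: jacobian_def)

section \<open>Principal divisors and orders of divisor classes\<close>

context genus2_curve
begin

lemma principal_add:
  assumes "D \<in> principal_divisors h f" "E \<in> principal_divisors h f"
  shows "D + E \<in> principal_divisors h f"
proof -
  obtain a b where a: "a \<noteq> 0" "\<forall>P\<in>places h f. Poly_Mapping.lookup D P = P a"
    and b: "b \<noteq> 0" "\<forall>P\<in>places h f. Poly_Mapping.lookup E P = P b"
    using assms unfolding principal_divisors_def by blast
  then have "a \<circledast> b \<noteq> 0" "\<forall>P\<in>places h f. Poly_Mapping.lookup (D + E) P = P (a \<circledast> b)"
    by (simp_all add: fmult_eq_0_iff lookup_add place_mult)
  then show ?thesis
    using assms divisors_deg0_add unfolding principal_divisors_def by blast
qed

lemma principal_minus:
  assumes "D \<in> principal_divisors h f"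
  shows "- D \<in> principal_divisors h f"
proof -
  obtain a where a: "a \<noteq> 0" "\<forall>P\<in>places h f. Poly_Mapping.lookup D P = P a"
    using assms unfolding principal_divisors_def by blast
  obtain b where b: "b \<noteq> 0" "a \<circledast> b = rat_fun 1" using inverse_exists[OF a(1)] by blast
  have "P a + P b = 0" if "P \<in> places h f" for P
    using place_mult[OF that a(1) b(1)] b(2) place_one[OF that] by simp
  then have "\<forall>P\<in>places h f. Poly_Mapping.lookup (- D) P = P b"
    using a(2) by (simp add: add_eq_0_iff)
  then show ?thesis
    using assms b(1) divisors_deg0_minus unfolding principal_divisors_def by blast
qed

lemma principal_zero: "0 \<in> principal_divisors h f"
proof -
  have "rat_fun 1 \<noteq> 0 \<and> (\<forall>P\<in>places h f. Poly_Mapping.lookup 0 P = P (rat_fun 1))"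
    by (simp add: place_one)
  then show ?thesis unfolding principal_divisors_def using divisors_deg0_zero by blast
qed

lemma principal_diff:
  "D \<in> principal_divisors h f \<Longrightarrow> E \<in> principal_divisors h f \<Longrightarrow> D - E \<in> principal_divisors h f"
  using principal_add[of D "- E"] principal_minus by simp

lemma principal_cmul:
  assumes "D \<in> principal_divisors h f"
  shows "frag_cmul (int n) D \<in> principal_divisors h f"
proof (induction n)
  case 0
  then show ?case by (simp add: principal_zero)
next
  case (Suc n)
  then show ?case using principal_add[OF assms] by (simp add: frag_cmul_distrib)
qed

lemma principal_subset: "principal_divisors h f \<subseteq> divisors_deg0 h f"
  by (auto simp: principal_divisors_def)

lemma normal_principal: "principal_divisors h f \<lhd> deg0_group h f"
proof -
  interpret comm_group "deg0_group h f" by (rule comm_group_deg0)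
  have "subgroup (principal_divisors h f) (deg0_group h f)"
    using principal_subset deg0_group_inv principal_add principal_minus principal_zero
    by unfold_locales auto
  then show ?thesis by (rule subgroup_imp_normal)
qed

abbreviation divisor_class :: "divisor \<Rightarrow> divisor set" where
  "divisor_class D \<equiv> principal_divisors h f #>\<^bsub>deg0_group h f\<^esub> D"

lemma divisor_class_eq: "divisor_class D = (\<lambda>p. p + D) ` principal_divisors h f"
  by (auto simp: r_coset_def)

lemma divisor_class_in_carrier: "D \<in> divisors_deg0 h f \<Longrightarrow> divisor_class D \<in> carrier (jacobian h f)"
  by (simp add: jacobian_eq carrier_FactGroup)

text \<open>Reduces every question about the order of a class to whether multiples of the divisor
  are principal.\<close>

lemma ord_divisor_class_dvd:
  assumes D: "D \<in> divisors_deg0 h f"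
  shows "group.ord (jacobian h f) (divisor_class D) dvd n \<longleftrightarrow>
    frag_cmul (int n) D \<in> principal_divisors h f"
proof -
  interpret normal "principal_divisors h f" "deg0_group h f" by (rule normal_principal)
  have grp: "group (jacobian h f)" unfolding jacobian_eq by (rule factorgroup_is_group)
  interpret J: group_hom "deg0_group h f" "jacobian h f" "\<lambda>a. divisor_class a"
    using r_coset_hom_Mod grp comm_group.axioms(2)[OF comm_group_deg0]
    by (intro group_hom.intro group_hom_axioms.intro) (simp_all add: jacobian_eq)
  have "group.ord (jacobian h f) (divisor_class D) dvd n \<longleftrightarrow>
      divisor_class D [^]\<^bsub>jacobian h f\<^esub> n = \<one>\<^bsub>jacobian h f\<^esub>"
    using group.pow_eq_id[OF grp divisor_class_in_carrier[OF D]] by simp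
  also have "divisor_class D [^]\<^bsub>jacobian h f\<^esub> n = divisor_class (frag_cmul (int n) D)"
    using J.hom_nat_pow[of D n] D by (simp add: deg0_group_pow)
  also have "divisor_class (frag_cmul (int n) D) = \<one>\<^bsub>jacobian h f\<^esub> \<longleftrightarrow>
      frag_cmul (int n) D \<in> principal_divisors h f"
  proof
    assume "divisor_class (frag_cmul (int n) D) = \<one>\<^bsub>jacobian h f\<^esub>"
    then have "0 + frag_cmul (int n) D \<in> principal_divisors h f"
      using principal_zero unfolding divisor_class_eq by (auto simp: jacobian_eq)
    then show "frag_cmul (int n) D \<in> principal_divisors h f" by simp
  next
    assume m: "frag_cmul (int n) D \<in> principal_divisors h f"
    have "p \<in> divisor_class (frag_cmul (int n) D)" if "p \<in> principal_divisors h f" for p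
      using principal_diff[OF that m] unfolding divisor_class_eq by (auto intro!: image_eqI)
    then show "divisor_class (frag_cmul (int n) D) = \<one>\<^bsub>jacobian h f\<^esub>"
      using principal_add[OF _ m] unfolding divisor_class_eq by (auto simp: jacobian_eq)
  qed
  finally show ?thesis .
qed

section \<open>The Galois action\<close>

lemma galois_groupD:
  assumes "\<sigma> \<in> galois_group"
  shows "bij \<sigma>" "\<sigma> (a + b) = \<sigma> a + \<sigma> b" "\<sigma> (a * b) = \<sigma> a * \<sigma> b" "\<sigma> (to_ac q) = to_ac q"
    "\<sigma> 0 = 0" "\<sigma> 1 = 1" "\<sigma> a = 0 \<longleftrightarrow> a = 0"
proof -
  show b: "bij \<sigma>" and "\<sigma> (a + b) = \<sigma> a + \<sigma> b" "\<sigma> (a * b) = \<sigma> a * \<sigma> b"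
    and q: "\<And>q. \<sigma> (to_ac q) = to_ac q"
    using assms unfolding galois_group_def by blast+
  show z: "\<sigma> 0 = 0" "\<sigma> 1 = 1" using q[of 0] q[of 1] by simp_all
  show "\<sigma> a = 0 \<longleftrightarrow> a = 0" using z b by (metis bij_is_inj inj_eq)
qed

lemma galois_group_inv:
  assumes "\<sigma> \<in> galois_group"
  shows "inv_into UNIV \<sigma> \<in> galois_group"
proof -
  note g = galois_groupD[OF assms]
  have i: "inv_into UNIV \<sigma> (\<sigma> a) = a" "\<sigma> (inv_into UNIV \<sigma> a) = a" for a
    using g(1) by (simp_all add: bij_is_inj bij_is_surj surj_f_inv_f)
  show ?thesis
    unfolding galois_group_def
    using g(1) by (auto simp: bij_imp_bij_inv) (metis i g(2-4))+
qed

lemma inv_inv_galois: "\<sigma> \<in> galois_group \<Longrightarrow> inv_into UNIV (inv_into UNIV \<sigma>) = \<sigma>"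
  by (simp add: galois_groupD(1) inv_inv_eq)

lemma galois_map_poly:
  assumes "\<sigma> \<in> galois_group"
  shows "map_poly \<sigma> (p + q) = map_poly \<sigma> p + map_poly \<sigma> q"
    "map_poly \<sigma> (p * q) = map_poly \<sigma> p * map_poly \<sigma> q"
    "map_poly \<sigma> p = 0 \<longleftrightarrow> p = 0"
    "map_poly \<sigma> (base_change s) = base_change s"
  using galois_groupD[OF assms]
  by (simp_all add: map_poly_hom_add map_poly_hom_mult map_poly_eq_0_iff map_poly_map_poly o_def)

text \<open>\<open>galois_fract\<close> acts on the normalised numerator and denominator.
  Cross-multiplying shows that any other representation gives the same result, from which the
  homomorphism laws follow.\<close>

lemma galois_fract_divide:
  assumes \<sigma>: "\<sigma> \<in> galois_group" and q: "q \<noteq> 0"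
  shows "galois_fract \<sigma> (to_fract p / to_fract q) = to_fract (map_poly \<sigma> p) / to_fract (map_poly \<sigma> q)"
proof -
  let ?r = "to_fract p / to_fract q"
  let ?p = "fst (quot_of_fract ?r)" and ?q = "snd (quot_of_fract ?r)"
  have "to_fract ?p / to_fract ?q = to_fract p / to_fract q"
    by (metis Fract_conv_to_fract Fract_quot_of_fract)
  then have "to_fract (?p * q) = to_fract (p * ?q)" using q by (simp add: field_simps)
  then have "?p * q = p * ?q" by (simp only: to_fract_eq_iff)
  then have "map_poly \<sigma> ?p * map_poly \<sigma> q = map_poly \<sigma> p * map_poly \<sigma> ?q"
    by (metis galois_map_poly(2)[OF \<sigma>])
  then have "to_fract (map_poly \<sigma> ?p) * to_fract (map_poly \<sigma> q)
      = to_fract (map_poly \<sigma> p) * to_fract (map_poly \<sigma> ?q)"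
    by (metis to_fract_mult)
  then show ?thesis
    using q galois_map_poly(3)[OF \<sigma>]
    by (simp add: galois_fract_def case_prod_unfold Let_def Fract_conv_to_fract frac_eq_eq)
qed

lemma fract_cases: "\<exists>p q. q \<noteq> 0 \<and> r = to_fract p / to_fract q" for r :: "Qbar poly fract"
  by (metis Fract_conv_to_fract Fract_quot_of_fract snd_quot_of_fract_nonzero)

lemma galois_fract_poly:
  assumes "\<sigma> \<in> galois_group"
  shows "galois_fract \<sigma> (to_fract p) = to_fract (map_poly \<sigma> p)"
  using galois_fract_divide[OF assms, of 1 p] galois_groupD(6)[OF assms] by simp

lemma galois_fract_hom:
  assumes \<sigma>: "\<sigma> \<in> galois_group"
  shows "galois_fract \<sigma> (r + s) = galois_fract \<sigma> r + galois_fract \<sigma> s"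
    "galois_fract \<sigma> (r * s) = galois_fract \<sigma> r * galois_fract \<sigma> s"
proof -
  note m = galois_map_poly[OF \<sigma>]
  obtain p q where 1: "q \<noteq> 0" "r = to_fract p / to_fract q" using fract_cases by blast
  obtain p' q' where 2: "q' \<noteq> 0" "s = to_fract p' / to_fract q'" using fract_cases by blast
  have "r + s = to_fract (p * q' + p' * q) / to_fract (q * q')"
    using 1 2 by (simp add: add_frac_eq)
  then have "galois_fract \<sigma> (r + s)
      = to_fract (map_poly \<sigma> (p * q' + p' * q)) / to_fract (map_poly \<sigma> (q * q'))"
    using galois_fract_divide[OF \<sigma>, of "q * q'"] 1 2 by (metis mult_eq_0_iff)
  then show "galois_fract \<sigma> (r + s) = galois_fract \<sigma> r + galois_fract \<sigma> s"
    using 1 2 m by (simp add: galois_fract_divide[OF \<sigma>] add_frac_eq)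
  have "r * s = to_fract (p * p') / to_fract (q * q')" by (simp add: 1 2)
  then have "galois_fract \<sigma> (r * s) = to_fract (map_poly \<sigma> (p * p')) / to_fract (map_poly \<sigma> (q * q'))"
    using galois_fract_divide[OF \<sigma>, of "q * q'"] 1 2 by (metis mult_eq_0_iff)
  then show "galois_fract \<sigma> (r * s) = galois_fract \<sigma> r * galois_fract \<sigma> s"
    using 1 2 m by (simp add: galois_fract_divide[OF \<sigma>])
qed

lemma galois_fract_inv:
  assumes \<sigma>: "\<sigma> \<in> galois_group"
  shows "galois_fract (inv_into UNIV \<sigma>) (galois_fract \<sigma> r) = r"
proof -
  obtain p q where 1: "q \<noteq> 0" "r = to_fract p / to_fract q" using fract_cases by blast
  have "map_poly (inv_into UNIV \<sigma>) (map_poly \<sigma> s) = s" for s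
    using galois_groupD[OF \<sigma>] galois_groupD(5)[OF galois_group_inv[OF \<sigma>]]
    by (simp add: map_poly_map_poly o_def bij_is_inj)
  then show ?thesis
    using 1 galois_map_poly(3)[OF \<sigma>]
    by (simp add: galois_fract_divide[OF \<sigma>] galois_fract_divide[OF galois_group_inv[OF \<sigma>]])
qed

lemma galois_ff_inv:
  assumes "\<sigma> \<in> galois_group"
  shows "galois_ff (inv_into UNIV \<sigma>) (galois_ff \<sigma> u) = u"
    and "galois_ff \<sigma> (galois_ff (inv_into UNIV \<sigma>) u) = u"
  using galois_fract_inv[OF assms] galois_fract_inv[OF galois_group_inv[OF assms]]
  by (simp_all add: galois_ff_def inv_inv_galois[OF assms])

lemma galois_ff_add:
  "\<sigma> \<in> galois_group \<Longrightarrow> galois_ff \<sigma> (u + w) = galois_ff \<sigma> u + galois_ff \<sigma> w"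
  by (simp add: galois_ff_def galois_fract_hom)

lemma galois_fract_minus:
  assumes "\<sigma> \<in> galois_group"
  shows "galois_fract \<sigma> (- r) = - galois_fract \<sigma> r"
proof -
  have "galois_fract \<sigma> 0 = 0" using galois_fract_poly[OF assms, of 0] by simp
  then show ?thesis
    using galois_fract_hom(1)[OF assms, of r "- r"] by (simp add: add_eq_0_iff)
qed

lemma galois_ff_mult:
  assumes "\<sigma> \<in> galois_group"
  shows "galois_ff \<sigma> (u \<circledast> w) = galois_ff \<sigma> u \<circledast> galois_ff \<sigma> w"
  using galois_fract_minus[OF assms]
  by (simp add: galois_ff_def ff_mult_def Let_def galois_fract_hom[OF assms] galois_fract_poly[OF assms]
      galois_map_poly[OF assms] diff_conv_add_uminus del: add_uminus_conv_diff)

lemma galois_ff_conj: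
  assumes "\<sigma> \<in> galois_group"
  shows "galois_ff \<sigma> (ff_conj u) = ff_conj (galois_ff \<sigma> u)"
  using galois_fract_minus[OF assms]
  by (simp add: galois_ff_def ff_conj_def galois_fract_hom[OF assms] galois_fract_poly[OF assms]
      galois_map_poly[OF assms] diff_conv_add_uminus del: add_uminus_conv_diff)

lemma galois_ff_rational:
  assumes "\<sigma> \<in> galois_group"
  shows "galois_ff \<sigma> (to_fract (base_change a), to_fract (base_change b))
    = (to_fract (base_change a), to_fract (base_change b))"
  by (simp add: galois_ff_def galois_fract_poly[OF assms] galois_map_poly[OF assms])

lemma galois_ff_eq_0_iff:
  assumes "\<sigma> \<in> galois_group"
  shows "galois_ff \<sigma> u = 0 \<longleftrightarrow> u = 0"
proof -
  have "galois_ff \<tau> 0 = 0" if "\<tau> \<in> galois_group" for \<tau>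
    using galois_ff_rational[OF that, of 0 0] by (simp add: zero_prod_def)
  then show ?thesis using assms galois_group_inv galois_ff_inv(1) by metis
qed

section \<open>The Galois action on places and divisors\<close>

lemma galois_place_in_places:
  assumes \<sigma>: "\<sigma> \<in> galois_group" and v: "v \<in> places h f"
  shows "galois_place \<sigma> v \<in> places h f"
proof -
  let ?\<tau> = "inv_into UNIV \<sigma>"
  have \<tau>: "?\<tau> \<in> galois_group" by (rule galois_group_inv[OF \<sigma>])
  note [simp] = galois_ff_eq_0_iff[OF \<tau>]
  obtain t where "t \<noteq> 0" "v t = 1" using place_uniformizer[OF v] by blast
  then have "\<exists>t. t \<noteq> 0 \<and> v (galois_ff ?\<tau> t) = 1"
    using galois_ff_inv(1)[OF \<sigma>] galois_ff_eq_0_iff[OF \<sigma>] by (metis (no_types))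
  moreover have "min (v (galois_ff ?\<tau> a)) (v (galois_ff ?\<tau> b)) \<le> v (galois_ff ?\<tau> (a + b))"
    if "a \<noteq> 0" "b \<noteq> 0" "a + b \<noteq> 0" for a b
    using place_add[OF v, of "galois_ff ?\<tau> a" "galois_ff ?\<tau> b"] that
    by (simp flip: galois_ff_add[OF \<tau>])
  moreover have "v (galois_ff ?\<tau> (a \<circledast> b)) = v (galois_ff ?\<tau> a) + v (galois_ff ?\<tau> b)"
    if "a \<noteq> 0" "b \<noteq> 0" for a b
    using place_mult[OF v, of "galois_ff ?\<tau> a" "galois_ff ?\<tau> b"] that by (simp add: galois_ff_mult[OF \<tau>])
  moreover have "v (galois_ff ?\<tau> (ff_const c)) = 0" if "c \<noteq> 0" for c
  proof -
    have "galois_ff ?\<tau> (ff_const c) = poly_fun [:?\<tau> c:]"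
      using galois_fract_poly[OF \<tau>, of "[:c:]"] galois_fract_poly[OF \<tau>, of 0] galois_groupD(5)[OF \<tau>]
      by (simp add: galois_ff_def ff_const_def map_poly_pCons)
    then show ?thesis using place_const[OF v] galois_groupD(7)[OF \<tau>] that by simp
  qed
  moreover have "v (galois_ff ?\<tau> 0) = 0"
    using place_zero[OF v] galois_ff_eq_0_iff[OF \<tau>, of 0] by metis
  ultimately show ?thesis unfolding places_def galois_place_def by blast
qed

lemma galois_place_inv:
  assumes "\<sigma> \<in> galois_group"
  shows "galois_place \<sigma> (galois_place (inv_into UNIV \<sigma>) v) = v"
  using galois_ff_inv(2)[OF assms] by (simp add: galois_place_def inv_inv_galois[OF assms])

lemma inj_galois_place:
  assumes "\<sigma> \<in> galois_group"
  shows "inj (galois_place \<sigma>)"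
  using galois_place_inv[OF galois_group_inv[OF assms]] inv_inv_galois[OF assms]
  by (metis injI)

lemma galois_divisor_diff: "galois_divisor \<sigma> (D - E) = galois_divisor \<sigma> D - galois_divisor \<sigma> E"
  and galois_divisor_add: "galois_divisor \<sigma> (D + E) = galois_divisor \<sigma> D + galois_divisor \<sigma> E"
  and galois_divisor_0: "galois_divisor \<sigma> 0 = 0"
  and galois_divisor_frag_of: "galois_divisor \<sigma> (frag_of P) = frag_of (galois_place \<sigma> P)"
  by (simp_all add: galois_divisor_def frag_extend_diff frag_extend_add)

lemma lookup_galois_divisor:
  assumes "\<sigma> \<in> galois_group"
  shows "Poly_Mapping.lookup (galois_divisor \<sigma> D) (galois_place \<sigma> P) = Poly_Mapping.lookup D P"
  using subset_UNIV[of "Poly_Mapping.keys D"]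
proof (induction D rule: frag_induction)
  case (one Q)
  show ?case
    using inj_galois_place[OF assms]
    by (simp add: galois_divisor_frag_of lookup_single when_def inj_eq)
qed (simp_all add: galois_divisor_0 galois_divisor_diff lookup_minus)

lemma deg_galois_divisor: "deg_divisor (galois_divisor \<sigma> D) = deg_divisor D"
  using subset_UNIV[of "Poly_Mapping.keys D"]
  by (induction D rule: frag_induction)
     (simp_all add: galois_divisor_0 galois_divisor_diff galois_divisor_frag_of deg_divisor_diff)

lemma galois_divisor_inv:
  assumes "\<sigma> \<in> galois_group"
  shows "galois_divisor \<sigma> (galois_divisor (inv_into UNIV \<sigma>) D) = D"
  using subset_UNIV[of "Poly_Mapping.keys D"]
  by (induction D rule: frag_induction)
     (simp_all add: galois_divisor_0 galois_divisor_diff galois_divisor_frag_of galois_place_inv[OF assms])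

lemma galois_divisor_deg0:
  assumes \<sigma>: "\<sigma> \<in> galois_group" and D: "D \<in> divisors_deg0 h f"
  shows "galois_divisor \<sigma> D \<in> divisors_deg0 h f"
proof -
  have "Poly_Mapping.keys (galois_divisor \<sigma> D)
      \<subseteq> (\<Union>P\<in>Poly_Mapping.keys D. Poly_Mapping.keys (frag_of (galois_place \<sigma> P)))"
    unfolding galois_divisor_def by (rule keys_frag_extend)
  also have "\<dots> \<subseteq> places h f"
    using D galois_place_in_places[OF \<sigma>] by (auto simp: divisors_deg0_iff)
  finally show ?thesis using D by (simp add: divisors_deg0_iff deg_galois_divisor)
qed

text \<open>If D is the divisor of g, its image is the divisor of \<sigma> g.\<close>

lemma galois_divisor_principal:
  assumes \<sigma>: "\<sigma> \<in> galois_group" and D: "D \<in> principal_divisors h f"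
  shows "galois_divisor \<sigma> D \<in> principal_divisors h f"
proof -
  let ?\<tau> = "inv_into UNIV \<sigma>"
  obtain g where g: "g \<noteq> 0" "\<forall>P\<in>places h f. Poly_Mapping.lookup D P = P g"
    using D unfolding principal_divisors_def by blast
  have "Poly_Mapping.lookup (galois_divisor \<sigma> D) P = P (galois_ff \<sigma> g)" if P: "P \<in> places h f" for P
  proof -
    have "Poly_Mapping.lookup (galois_divisor \<sigma> D) (galois_place \<sigma> (galois_place ?\<tau> P))
        = Poly_Mapping.lookup D (galois_place ?\<tau> P)"
      by (rule lookup_galois_divisor[OF \<sigma>])
    also have "\<dots> = galois_place ?\<tau> P g"
      using g(2) galois_place_in_places[OF galois_group_inv[OF \<sigma>] P] by blast
    finally show ?thesis
      unfolding galois_place_inv[OF \<sigma>] by (simp add: galois_place_def inv_inv_galois[OF \<sigma>])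
  qed
  moreover have "galois_ff \<sigma> g \<noteq> 0" using g(1) galois_ff_eq_0_iff[OF \<sigma>] by simp
  moreover have "galois_divisor \<sigma> D \<in> divisors_deg0 h f"
    using D galois_divisor_deg0[OF \<sigma>] principal_subset by blast
  ultimately show ?thesis unfolding principal_divisors_def by blast
qed

text \<open>Principal divisors are Galois-stable, so their translate by a fixed divisor is mapped
  into itself; it is mapped onto itself because the inverse automorphism acts as well.\<close>

lemma divisor_class_rational:
  assumes D: "D \<in> divisors_deg0 h f" and fixed: "\<And>\<sigma>. \<sigma> \<in> galois_group \<Longrightarrow> galois_divisor \<sigma> D = D"
  shows "divisor_class D \<in> jacobian_rational_points h f"
proof -
  have "galois_divisor \<sigma> ` divisor_class D = divisor_class D" if \<sigma>: "\<sigma> \<in> galois_group" for \<sigma>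
  proof
    show "galois_divisor \<sigma> ` divisor_class D \<subseteq> divisor_class D"
      using galois_divisor_principal[OF \<sigma>] unfolding divisor_class_eq
      by (auto simp: galois_divisor_add fixed[OF \<sigma>])
    show "divisor_class D \<subseteq> galois_divisor \<sigma> ` divisor_class D"
    proof
      fix E assume "E \<in> divisor_class D"
      then obtain p where p: "p \<in> principal_divisors h f" "E = p + D"
        unfolding divisor_class_eq by blast
      let ?p = "galois_divisor (inv_into UNIV \<sigma>) p"
      have "?p + D \<in> divisor_class D"
        using galois_divisor_principal[OF galois_group_inv[OF \<sigma>] p(1)] unfolding divisor_class_eq by blast
      moreover have "galois_divisor \<sigma> (?p + D) = E"
        by (simp add: galois_divisor_add galois_divisor_inv[OF \<sigma>] fixed[OF \<sigma>] p(2))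
      ultimately show "E \<in> galois_divisor \<sigma> ` divisor_class D" by blast
    qed
  qed
  then show ?thesis
    using divisor_class_in_carrier[OF D] by (simp add: jacobian_rational_points_def)
qed

text \<open>x and y are fixed by \<sigma>, so the image satisfies \<open>at_plus\<close>, which has
  only one solution.\<close>

lemma galois_place_plus: 
  assumes \<sigma>: "\<sigma> \<in> galois_group"
  shows "galois_place \<sigma> plus_place = plus_place"
proof -
  have "galois_ff (inv_into UNIV \<sigma>) x_fun = x_fun" "galois_ff (inv_into UNIV \<sigma>) y_fun = y_fun"
    using galois_ff_rational[OF galois_group_inv[OF \<sigma>], of "[:0, 1:]" 0]
      galois_ff_rational[OF galois_group_inv[OF \<sigma>], of 0 1] by (simp_all add: map_poly_pCons)
  then have "at_plus (galois_place \<sigma> plus_place)"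
    using plus_place galois_place_in_places[OF \<sigma>] by (simp add: at_plus_def galois_place_def)
  then show ?thesis by (simp add: at_plus_iff)
qed

lemma galois_place_minus:
  assumes \<sigma>: "\<sigma> \<in> galois_group"
  shows "galois_place \<sigma> minus_place = minus_place"
proof
  fix u
  show "galois_place \<sigma> minus_place u = minus_place u"
    using galois_place_plus[OF \<sigma>] galois_ff_conj[OF galois_group_inv[OF \<sigma>], of u]
    by (simp add: galois_place_def minus_place_def) metis
qed

lemma galois_place_point:
  assumes \<sigma>: "\<sigma> \<in> galois_group" and v: "at_point (to_ac c) (to_ac e) v"
    and on: "e\<^sup>2 + poly h c * e = poly f c" and unramified: "poly h c + 2 * e \<noteq> 0"
  shows "galois_place \<sigma> v = v"
proof -
  have p: "poly (base_change s) (to_ac c) = to_ac (poly s c)" for s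
    by (rule poly_map_poly_hom) simp_all
  have on': "(to_ac e)\<^sup>2 + poly (base_change h) (to_ac c) * to_ac e = poly (base_change f) (to_ac c)"
    unfolding p using on by (simp flip: to_ac_power to_ac_mult to_ac_add)
  have un': "poly (base_change h) (to_ac c) + 2 * to_ac e \<noteq> 0"
  proof -
    have "poly (base_change h) (to_ac c) + 2 * to_ac e = to_ac (poly h c + 2 * e)" by (simp add: p)
    then show ?thesis using unramified by (metis to_ac_eq_0_iff)
  qed
  have "galois_ff (inv_into UNIV \<sigma>) (poly_fun [:- to_ac c, 1:]) = poly_fun [:- to_ac c, 1:]"
    "galois_ff (inv_into UNIV \<sigma>) (to_fract [:- to_ac e:], 1) = (to_fract [:- to_ac e:], 1)"
    using galois_ff_rational[OF galois_group_inv[OF \<sigma>], of "[:-c, 1:]" 0]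
      galois_ff_rational[OF galois_group_inv[OF \<sigma>], of "[:-e:]" 1] by (simp_all add: map_poly_pCons)
  then have "at_point (to_ac c) (to_ac e) (galois_place \<sigma> v)"
    using v galois_place_in_places[OF \<sigma>] by (simp add: at_point_def galois_place_def)
  then show ?thesis using at_point_unique(2)[OF on' un'] v by blast
qed

end

section \<open>Certificates for the orders of divisor classes\<close>

text \<open>The Bezout identity certifies over the rationals that d = h^2 + 4 f has no multiple root
  over the closure. A singular affine point would give one, by 2 y = - h.\<close>

lemma genus2_modelI:
  fixes h f r s :: "rat poly"
  assumes h: "Polynomial.degree h = 3" and f: "Polynomial.degree f \<le> 3"
    and d: "d = h\<^sup>2 + smult 4 f" and bezout: "r * d + s * pderiv d = [:c:]" "c \<noteq> 0"
  shows "genus2_model h f"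
proof -
  let ?H = "base_change h" and ?F = "base_change f"
  have deriv: "pderiv (base_change p) = base_change (pderiv p)" for p
    by (rule poly_eqI) (simp add: coeff_pderiv coeff_map_poly)
  have sm: "base_change (smult 4 f) = smult 4 ?F"
    by (rule poly_eqI) (simp add: coeff_map_poly)
  have D: "base_change d = ?H\<^sup>2 + smult 4 ?F"
    by (simp add: d base_change_add base_change_mult power2_eq_square sm)
  have "base_change r * base_change d + base_change s * pderiv (base_change d) = [:to_ac c:]"
    using arg_cong[OF bezout(1), of base_change]
    by (simp add: base_change_add base_change_mult deriv map_poly_pCons)
  then have "poly (base_change r) x * poly (base_change d) x
      + poly (base_change s) x * poly (pderiv (base_change d)) x = to_ac c" for x
    by (metis poly_add poly_mult poly_const_conv)
  then have no_root: "\<not> (poly (base_change d) x = 0 \<and> poly (pderiv (base_change d)) x = 0)" for x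
    using bezout(2) by (metis add_0 mult_zero_right to_ac_eq_0_iff)
  have "\<nexists>x y. y\<^sup>2 + poly ?H x * y = poly ?F x \<and> poly (pderiv ?H) x * y = poly (pderiv ?F) x \<and>
      2 * y + poly ?H x = 0"
  proof safe
    fix x y
    assume 1: "y\<^sup>2 + poly ?H x * y = poly ?F x" and 2: "poly (pderiv ?H) x * y = poly (pderiv ?F) x"
      and 3: "2 * y + poly ?H x = 0"
    have hx: "poly ?H x = - 2 * y" using 3 by (simp add: add_eq_0_iff)
    have "poly (base_change d) x = 0"
      unfolding D using 1[symmetric] by (simp add: hx power2_eq_square algebra_simps)
    moreover have "poly (pderiv (base_change d)) x = 0"
      unfolding D using 2[symmetric]
      by (simp add: hx power2_eq_square pderiv_add pderiv_mult pderiv_smult algebra_simps)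
    ultimately show False using no_root by blast
  qed
  \<comment> \<open>As deg f <= 3, the coefficient of f in degree 6 vanishes. With h_3 the leading
    coefficient of h, 2 w = - h_3 and w (w + h_3) = 0 force h_3 = 0, against deg h = 3.\<close>
  moreover have "\<nexists>w. w\<^sup>2 + Polynomial.coeff ?H 3 * w = Polynomial.coeff ?F 6 \<and>
      Polynomial.coeff ?H 2 * w = Polynomial.coeff ?F 5 \<and> 2 * w + Polynomial.coeff ?H 3 = 0"
  proof safe
    fix w
    assume 1: "w\<^sup>2 + Polynomial.coeff ?H 3 * w = Polynomial.coeff ?F 6" and 2: "2 * w + Polynomial.coeff ?H 3 = 0"
    have "Polynomial.coeff ?F 6 = 0" using f by (intro coeff_eq_0) simp
    moreover have h3: "Polynomial.coeff ?H 3 = - 2 * w" using 2 by (simp add: add_eq_0_iff)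
    ultimately have "w = 0" using 1 by (simp add: power2_eq_square)
    then have "Polynomial.coeff ?H 3 = 0" using h3 by simp
    then show False using h by (metis degree_base_change degree_0 leading_coeff_0_iff zero_neq_numeral)
  qed
  ultimately show ?thesis using h f unfolding genus2_model_def Let_def by simp
qed

section \<open>Multiples of the difference of the infinite places, and flex points\<close>

context genus2_curve
begin

definition infinity_divisor :: divisor where
  "infinity_divisor = frag_of plus_place - frag_of minus_place"

abbreviation rational_function :: "rat poly \<Rightarrow> rat poly \<Rightarrow> function_field" where
  "rational_function a b \<equiv> (to_fract (base_change a), to_fract (base_change b))"

lemma difference_of_places_deg0:
  assumes "P \<in> places h f" "Q \<in> places h f"
  shows "frag_of P - frag_of Q \<in> divisors_deg0 h f"
  using assms keys_diff[of "frag_of P" "frag_of Q"]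
  by (auto simp: divisors_deg0_iff deg_divisor_diff)

lemma divisors_deg0_cmul: "D \<in> divisors_deg0 h f \<Longrightarrow> frag_cmul (int n) D \<in> divisors_deg0 h f"
  by (induction n) (auto simp: frag_cmul_distrib divisors_deg0_add divisors_deg0_zero)

lemma infinity_divisor_deg0: "infinity_divisor \<in> divisors_deg0 h f"
  unfolding infinity_divisor_def by (rule difference_of_places_deg0[OF plus_place(1) minus_place(1)])

lemma lookup_frag_of_diff:
  "Poly_Mapping.lookup (frag_of P - frag_of Q) v = (if v = P then 1 else 0) - (if v = Q then 1 else 0)"
  by (simp add: lookup_minus lookup_single when_def)

lemma rational_function_values:
  assumes n: "Polynomial.degree (a - b * h) = n" "Polynomial.degree b + 2 < n"
  shows "rational_function a b \<noteq> 0" "minus_place (rational_function a b) = - int n"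
    "ff_norm (rational_function a b) = to_fract (base_change (a\<^sup>2 - a * b * h - b\<^sup>2 * f))"
    "plus_place (rational_function a b) = int n - int (Polynomial.degree (a\<^sup>2 - a * b * h - b\<^sup>2 * f))"
proof -
  have "Polynomial.degree (base_change a - base_change b * base_change h) = n"
    using n(1) by (simp flip: base_change_mult base_change_diff)
  then show 1: "rational_function a b \<noteq> 0" and 2: "minus_place (rational_function a b) = - int n"
    using minus_place_value[of "base_change a" "base_change b" n] n(2) by simp_all
  show 3: "ff_norm (rational_function a b) = to_fract (base_change (a\<^sup>2 - a * b * h - b\<^sup>2 * f))"
    unfolding ff_norm_poly by (simp add: base_change_diff base_change_mult power2_eq_square)
  show "plus_place (rational_function a b) = int n - int (Polynomial.degree (a\<^sup>2 - a * b * h - b\<^sup>2 * f))"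
    using plus_minus_norm[OF 1 3] 2 by simp
qed

text \<open>The degree n of a - b h is the pole order at \<open>minus_place\<close>; a constant norm
  forces a zero of the same order at \<open>plus_place\<close>.\<close>

lemma infinity_divisor_multiple_principal:
  assumes n: "Polynomial.degree (a - b * h) = n" "Polynomial.degree b + 2 < n"
    and norm: "a\<^sup>2 - a * b * h - b\<^sup>2 * f = [:c:]"
  shows "frag_cmul (int n) infinity_divisor \<in> principal_divisors h f"
proof -
  let ?u = "rational_function a b"
  note u = rational_function_values[OF n]
  have "ff_norm ?u \<noteq> 0" using u(1) by simp
  then have c: "c \<noteq> 0" unfolding u(3) norm by auto
  have "Poly_Mapping.lookup (frag_cmul (int n) infinity_divisor) v = v ?u" if v: "v \<in> places h f" for v
  proof (cases "v x_fun < 0")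
    case True
    then show ?thesis
      using infinite_place_cases[OF v True] u plus_neq_minus
      by (auto simp: infinity_divisor_def lookup_frag_of_diff norm)
  next
    case False
    have "v (rat_fun (ff_norm ?u)) = 0"
      using place_const[OF v, of "to_ac c"] c unfolding u(3) norm by (simp add: map_poly_pCons)
    then have "v ?u = 0" using False finite_place_unit[OF v _ refl u(1)] by simp
    moreover have "v \<noteq> plus_place" "v \<noteq> minus_place" using False plus_place minus_place by auto
    ultimately show ?thesis by (simp add: infinity_divisor_def lookup_frag_of_diff)
  qed
  then show ?thesis
    unfolding principal_divisors_def
    using divisors_deg0_cmul[OF infinity_divisor_deg0] u(1) by blast
qed

text \<open>
  The functions \<open>a + b y\<close> used here come from convergents of the continued fraction of \<open>y\<close> at
  infinity. If \<open>k\<close> times the divisor were the divisor of \<open>g\<close>, then \<open>(a + b y) conj g\<close> would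
  have poles of order at most 2, and different orders at the two infinite places.
\<close>

lemma infinity_divisor_multiple_not_principal:
  assumes n: "Polynomial.degree (a - b * h) = n" "Polynomial.degree b + 2 < n"
    and l: "Polynomial.degree (a\<^sup>2 - a * b * h - b\<^sup>2 * f) = l"
    and bounds: "k + l \<le> n + 2" "n \<le> k + 2" "2 * k + l \<noteq> 2 * n"
  shows "frag_cmul (int k) infinity_divisor \<notin> principal_divisors h f"
proof
  assume "frag_cmul (int k) infinity_divisor \<in> principal_divisors h f"
  then obtain g where g: "g \<noteq> 0"
    "\<And>v. v \<in> places h f \<Longrightarrow> Poly_Mapping.lookup (frag_cmul (int k) infinity_divisor) v = v g"
    unfolding principal_divisors_def by blast
  have inf: "plus_place g = int k" "minus_place g = - int k"
    using g(2)[OF plus_place(1)] g(2)[OF minus_place(1)] plus_neq_minus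
    by (auto simp: infinity_divisor_def lookup_frag_of_diff)
  have fin: "v g = 0" if "v \<in> places h f" "v x_fun \<ge> 0" for v
  proof -
    have "v \<noteq> plus_place" "v \<noteq> minus_place" using that plus_place minus_place by auto
    then show ?thesis
      using g(2)[OF that(1)] by (simp add: infinity_divisor_def lookup_frag_of_diff)
  qed
  let ?u = "rational_function a b"
  note u = rational_function_values[OF n]
  have cg: "ff_conj g \<noteq> 0" using g by simp
  \<comment> \<open>Conjugation swaps the infinite places: \<open>ff_conj g\<close> has value - k at
    \<open>plus_place\<close> and k at \<open>minus_place\<close>, against n - l and - n for the
    function a + b y.\<close>
  define w where "w = ?u \<circledast> ff_conj g"
  have w: "v w = v ?u + v (ff_conj g)" if "v \<in> places h f" for v
    unfolding w_def using place_mult[OF that u(1) cg] .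
  have "plus_place w = int n - int l - int k" "minus_place w = int k - int n"
    using w[OF plus_place(1)] w[OF minus_place(1)] u inf l
    by (simp_all add: minus_place_def)
  moreover have "v w \<ge> 0" if v: "v \<in> places h f" "v x_fun \<ge> 0" for v
  proof -
    have "v (ff_conj g) = 0" using fin[OF place_conj[OF v(1)]] v(2) by simp
    then show ?thesis using w[OF v(1)] finite_place_nonneg[OF v u(1)] by simp
  qed
  moreover have "w \<noteq> 0" using u(1) cg by (simp add: w_def fmult_eq_0_iff)
  \<comment> \<open>The two inequalities in \<open>bounds\<close> say that n - l - k and k - n are
    at least - 2; the last condition says that they differ.\<close>
  ultimately show False using small_poles_imp_symmetric[of w] bounds by simp
qed

lemma infinity_divisor_rational:
  "\<sigma> \<in> galois_group \<Longrightarrow> galois_divisor \<sigma> infinity_divisor = infinity_divisor"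
  by (simp add: infinity_divisor_def galois_divisor_diff galois_divisor_frag_of
      galois_place_plus galois_place_minus)

text \<open>The order divides p^(k+1) but not p^k, so no other multiples have to be
  examined.\<close>

lemma rational_torsion_infinity_prime_power:
  assumes "prime p"
    and "frag_cmul (int (p ^ Suc k)) infinity_divisor \<in> principal_divisors h f"
    and "frag_cmul (int (p ^ k)) infinity_divisor \<notin> principal_divisors h f"
  shows "has_rational_torsion_of_order h f (p ^ Suc k)"
proof -
  let ?o = "group.ord (jacobian h f) (divisor_class infinity_divisor)"
  have "?o dvd p ^ Suc k" "\<not> ?o dvd p ^ k"
    using assms ord_divisor_class_dvd[OF infinity_divisor_deg0] by simp_all
  moreover from this obtain i where "i \<le> Suc k" "?o = p ^ i"
    using divides_primepow_nat[OF assms(1)] by blast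
  ultimately have "?o = p ^ Suc k"
    using le_imp_power_dvd[of i k p] by (cases "i = Suc k") auto
  moreover have "divisor_class infinity_divisor \<in> jacobian_rational_points h f"
    using divisor_class_rational[OF infinity_divisor_deg0 infinity_divisor_rational] .
  ultimately show ?thesis
    unfolding has_rational_torsion_of_order_def using assms(1) prime_gt_0_nat by auto
qed

text \<open>
  If \<open>y - e\<close> has norm a multiple of \<open>(x - c)\<^sup>3\<close>, its divisor is three times the difference of
  \<open>(c, e)\<close> and the infinite place at which \<open>y\<close> has a pole.
\<close>

lemma flex_divisor:
  fixes c e s :: rat
  assumes norm: "f - smult e h - [:e\<^sup>2:] = smult s ([:-c, 1:] ^ 3)"
    and unramified: "poly h c + 2 * e \<noteq> 0"
  shows "\<exists>T \<in> divisors_deg0 h f. frag_cmul 3 T \<in> principal_divisors h f \<and>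
    T \<notin> principal_divisors h f \<and> (\<forall>\<sigma>\<in>galois_group. galois_divisor \<sigma> T = T)"
proof -
  let ?c = "to_ac c" and ?e = "to_ac e"
  let ?u = "rational_function [:-e:] 1"
  have u': "?u = (to_fract [:-?e:], 1)" by (simp add: map_poly_pCons)
  have "poly (f - smult e h - [:e\<^sup>2:]) c = 0" unfolding norm by simp
  then have on: "e\<^sup>2 + poly h c * e = poly f c" by (simp add: algebra_simps)
  have p: "poly (base_change s) ?c = to_ac (poly s c)" for s
    by (rule poly_map_poly_hom) simp_all
  have on': "?e\<^sup>2 + poly (base_change h) ?c * ?e = poly (base_change f) ?c"
    unfolding p using on by (simp flip: to_ac_power to_ac_mult to_ac_add)
  have un': "poly (base_change h) ?c + 2 * ?e \<noteq> 0"
  proof -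
    have "poly (base_change h) ?c + 2 * ?e = to_ac (poly h c + 2 * e)" by (simp add: p)
    then show ?thesis using unramified by (metis to_ac_eq_0_iff)
  qed
  note unique = at_point_unique[OF on' un']
  obtain R where R: "at_point ?c ?e R" using at_point_exists[OF on'] by blast
  then have Rp: "R \<in> places h f" by (simp add: at_point_def)
  have Rx: "R x_fun \<ge> 0" using R place_point_finite unfolding at_point_def by blast
  have Rne: "R \<noteq> plus_place" "R \<noteq> minus_place" using Rx plus_place minus_place by auto
  define T where "T = frag_of R - frag_of minus_place"
  have T0: "T \<in> divisors_deg0 h f"
    unfolding T_def by (rule difference_of_places_deg0[OF Rp minus_place(1)])
  have dh: "Polynomial.degree ([:-e:] - 1 * h) = 3"
    using deg_h degree_add_eq_right[of "[:-e:]" "- h"] by simp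
  have d1: "Polynomial.degree (1 :: rat poly) + 2 < 3" by simp
  note u = rational_function_values[OF dh d1]
  have N: "[:-e:]\<^sup>2 - [:-e:] * 1 * h - 1\<^sup>2 * f = smult (- s) ([:-c, 1:] ^ 3)"
    using norm by (simp add: power2_eq_square algebra_simps)
  have "ff_norm ?u \<noteq> 0" using u(1) by simp
  then have s0: "s \<noteq> 0"
    using u(3) N by auto
  have normE: "ff_norm ?u = to_fract ([:to_ac (- s):] * [:-?c, 1:] ^ 3)"
  proof -
    have "smult (- s) ([:-c, 1:] ^ 3) = [:-s:] * ([:-c, 1:] * ([:-c, 1:] * [:-c, 1:]))"
      by (simp add: power3_eq_cube)
    then have "base_change (smult (- s) ([:-c, 1:] ^ 3))
        = base_change [:-s:] * (base_change [:-c, 1:] * (base_change [:-c, 1:] * base_change [:-c, 1:]))"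
      by (simp only: base_change_mult)
    then show ?thesis
      using u(3) unfolding N
      by (simp add: map_poly_pCons power3_eq_cube)
  qed
  have vnorm: "v (rat_fun (ff_norm ?u)) = 3 * v (poly_fun [:-?c, 1:])" if v: "v \<in> places h f" for v
  proof -
    interpret poly_valuation "\<lambda>p. v (poly_fun p)" by (rule poly_valuation_place[OF v])
    have "[:to_ac (- s):] \<noteq> 0" "[:-?c, 1:] ^ 3 \<noteq> 0" using s0 by auto
    then have "v (poly_fun ([:to_ac (- s):] * [:-?c, 1:] ^ 3))
        = v (poly_fun [:to_ac (- s):]) + v (poly_fun ([:-?c, 1:] ^ 3))" by (rule val_mult)
    also have "\<dots> = 3 * v (poly_fun [:-?c, 1:])"
      using val_power[of "[:-?c, 1:]" 3] val_const[of "to_ac (- s)"] s0 by simp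
    finally show ?thesis unfolding normE .
  qed
  have degN: "Polynomial.degree (smult (- s) ([:-c, 1:] ^ 3)) = 3"
    using s0 by (simp add: degree_power_eq)
  have inf: "plus_place ?u = 0" "minus_place ?u = - 3"
    using u(2,4) degN unfolding N by simp_all
  have "Poly_Mapping.lookup (frag_cmul 3 T) v = v ?u" if v: "v \<in> places h f" for v
  proof (cases "v x_fun < 0")
    case True
    then show ?thesis
      using infinite_place_cases[OF v True] inf plus_neq_minus Rne
      by (auto simp: T_def lookup_frag_of_diff)
  next
    case False
    then have fin: "v x_fun \<ge> 0" by simp
    have ne: "v \<noteq> minus_place" using False minus_place by auto
    have nonneg: "v ?u \<ge> 0" using finite_place_nonneg[OF v fin u(1)] .
    show ?thesis
    proof (cases "v = R")
      case True
      \<comment> \<open>x - c is a uniformizer at R and the conjugate of y - e is a unit there, so y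
        - e carries the whole value 3 of the norm.\<close>
      then have "v ?u = 3"
        using unique(1)[OF R] unique(3)[OF R] vnorm[OF v] unfolding u' by simp
      then show ?thesis using True ne by (simp add: T_def lookup_frag_of_diff)
    next
      case vR: False
      \<comment> \<open>Above c, R is the only zero of y - e; at the other finite places the norm is
        a unit.\<close>
      have "v ?u = 0"
      proof (cases "v (poly_fun [:-?c, 1:]) > 0")
        case True
        then have "\<not> v ?u > 0"
          using vR v unique(2)[OF R] unfolding u' by (auto simp: at_point_def)
        then show ?thesis using nonneg by simp
      next
        case False
        then have "v (poly_fun [:-?c, 1:]) = 0" using place_poly_finite[OF v fin, of "[:-?c, 1:]"] by simp
        then show ?thesis
          using vnorm[OF v] by (intro finite_place_unit[OF v fin refl u(1)]) simp
      qed
      then show ?thesis using vR ne by (simp add: T_def lookup_frag_of_diff)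
    qed
  qed
  then have "frag_cmul 3 T \<in> principal_divisors h f"
    unfolding principal_divisors_def
    using divisors_deg0_cmul[OF T0, of 3] u(1) by auto
  moreover have "T \<notin> principal_divisors h f"
  proof
    \<comment> \<open>A function g with divisor T would have a simple pole at
      \<open>minus_place\<close>, value 0 at \<open>plus_place\<close> and no finite poles, against
      the symmetry of functions with small poles.\<close>
    assume "T \<in> principal_divisors h f"
    then obtain g where g: "g \<noteq> 0" "\<And>v. v \<in> places h f \<Longrightarrow> Poly_Mapping.lookup T v = v g"
      unfolding principal_divisors_def by blast
    have T: "Poly_Mapping.lookup T v = (if v = R then 1 else 0) - (if v = minus_place then 1 else 0)" for v
      by (simp add: T_def lookup_frag_of_diff)
    have "plus_place g = 0" "minus_place g = - 1"
      using g(2)[OF plus_place(1)] g(2)[OF minus_place(1)] Rne plus_neq_minus by (auto simp: T)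
    moreover have "v g \<ge> 0" if "v \<in> places h f" "v x_fun \<ge> 0" for v
    proof -
      have "v \<noteq> minus_place" using that minus_place by auto
      then show ?thesis using g(2)[OF that(1)] by (auto simp: T split: if_splits)
    qed
    ultimately show False using small_poles_imp_symmetric[OF g(1)] by simp
  qed
  moreover have "galois_divisor \<sigma> T = T" if \<sigma>: "\<sigma> \<in> galois_group" for \<sigma>
    using galois_place_point[OF \<sigma> R on unramified] galois_place_minus[OF \<sigma>]
    by (simp add: T_def galois_divisor_diff galois_divisor_frag_of)
  ultimately show ?thesis using T0 by blast
qed

text \<open>The class of T + D is tested, with D = \<open>infinity_divisor\<close>. Its order
  divides 39. Since 13 - 4 * 3 = 1, D is recovered from 13 D and 3 (T + D) - 3 T, and T from 13 (T +
  D) - 13 D and 3 T; so the order divides neither 3 nor 13.\<close>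

lemma rational_torsion_39:
  fixes c e s :: rat
  assumes norm: "f - smult e h - [:e\<^sup>2:] = smult s ([:-c, 1:] ^ 3)"
    and unramified: "poly h c + 2 * e \<noteq> 0"
    and D13: "frag_cmul 13 infinity_divisor \<in> principal_divisors h f"
    and D1: "infinity_divisor \<notin> principal_divisors h f"
  shows "has_rational_torsion_of_order h f 39"
proof -
  let ?D = infinity_divisor
  obtain T where T0: "T \<in> divisors_deg0 h f" and T3: "frag_cmul 3 T \<in> principal_divisors h f"
    and T1: "T \<notin> principal_divisors h f" and Tg: "\<forall>\<sigma>\<in>galois_group. galois_divisor \<sigma> T = T"
    using flex_divisor[OF norm unramified] by blast
  let ?E = "T + ?D"
  let ?o = "group.ord (jacobian h f) (divisor_class ?E)"
  have E0: "?E \<in> divisors_deg0 h f" by (intro divisors_deg0_add T0 infinity_divisor_deg0)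
  note dvd = ord_divisor_class_dvd[OF E0]
  have "frag_cmul 39 ?E = frag_cmul 13 (frag_cmul 3 T) + frag_cmul 3 (frag_cmul 13 ?D)"
    by (rule poly_mapping_eqI) (simp add: lookup_add)
  then have "?o dvd 39"
    using principal_add[OF principal_cmul[OF T3, of 13] principal_cmul[OF D13, of 3]] dvd[of 39] by simp
  then obtain i j where ij: "?o = i * j" "i dvd 3" "j dvd 13"
    using division_decomp[of ?o 3 13] by auto
  have "\<not> ?o dvd 3"
  proof
    assume "?o dvd 3"
    then have "frag_cmul 3 ?E \<in> principal_divisors h f" using dvd[of 3] by simp
    then have "frag_cmul 3 ?E - frag_cmul 3 T \<in> principal_divisors h f"
      using T3 by (intro principal_diff)
    then have "frag_cmul 4 (frag_cmul 3 ?E - frag_cmul 3 T) \<in> principal_divisors h f"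
      using principal_cmul[of "frag_cmul 3 ?E - frag_cmul 3 T" 4] by simp
    then have "frag_cmul 13 ?D - frag_cmul 4 (frag_cmul 3 ?E - frag_cmul 3 T) \<in> principal_divisors h f"
      by (rule principal_diff[OF D13])
    moreover have "frag_cmul 13 ?D - frag_cmul 4 (frag_cmul 3 ?E - frag_cmul 3 T) = ?D"
      by (rule poly_mapping_eqI) (simp add: lookup_add lookup_minus)
    ultimately show False using D1 by simp
  qed
  moreover have "\<not> ?o dvd 13"
  proof
    assume "?o dvd 13"
    then have "frag_cmul 13 ?E \<in> principal_divisors h f" using dvd[of 13] by simp
    then have "frag_cmul 13 ?E - frag_cmul 13 ?D \<in> principal_divisors h f"
      using D13 by (intro principal_diff)
    moreover have "frag_cmul 4 (frag_cmul 3 T) \<in> principal_divisors h f"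
      using principal_cmul[OF T3, of 4] by simp
    ultimately have "frag_cmul 13 ?E - frag_cmul 13 ?D - frag_cmul 4 (frag_cmul 3 T) \<in> principal_divisors h f"
      by (rule principal_diff)
    moreover have "frag_cmul 13 ?E - frag_cmul 13 ?D - frag_cmul 4 (frag_cmul 3 T) = T"
      by (rule poly_mapping_eqI) (simp add: lookup_add lookup_minus)
    ultimately show False using T1 by simp
  qed
  moreover have "i = 1 \<or> i = 3" "j = 1 \<or> j = 13"
  proof -
    have "prime (3::nat)" "prime (13::nat)" by simp_all
    then show "i = 1 \<or> i = 3" "j = 1 \<or> j = 13" using ij prime_nat_iff by blast+
  qed
  ultimately have "?o = 39" using ij by auto
  moreover have "divisor_class ?E \<in> jacobian_rational_points h f"
    using Tg infinity_divisor_rational by (intro divisor_class_rational[OF E0]) (simp add: galois_divisor_add)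
  ultimately show ?thesis unfolding has_rational_torsion_of_order_def by auto
qed

end

section \<open>The four curves\<close>

lemma curve_1:
  "genus2_model [:1, -2, 0, 1:] [:0, 0, 0, 1:]" "has_rational_torsion_of_order [:1, -2, 0, 1:] [:0, 0, 0, 1:] 27"
proof -
  let ?h = "[:1, -2, 0, 1:] :: rat poly" and ?f = "[:0, 0, 0, 1:] :: rat poly"
  let ?d = "[:1, -4, 4, 6, -4, 0, 1:] :: rat poly"
  \<comment> \<open>Bezout cofactors of d and its derivative, scaled to integer
    coefficients.\<close>
  let ?r = "[:-57308, -52172, 66986, -9258, -25590:] :: rat poly"
  let ?s = "[:-9495, 25275, 19433, -16851, 1543, 4265:] :: rat poly"
  show model: "genus2_model ?h ?f"
  proof (rule genus2_modelI)
    show "?d = ?h\<^sup>2 + smult 4 ?f" by (simp add: power2_eq_square)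
    show "?r * ?d + ?s * pderiv ?d = [:-19328:]" by (simp add: pderiv_pCons)
  qed simp_all
  interpret genus2_curve ?h ?f
    by unfold_locales (use model in simp_all)
  \<comment> \<open>a + b y is a unit of the coordinate ring K[x, y], with pole order 27 = deg b + 3
    at \<open>minus_place\<close>.\<close>
  let ?a = "[:-1, -7, -33, -4214, 11940, -852, -30343, 26513, 25356, -44701, -1277, 34692, -12462, -14632,
      10083, 3095, -4100, -75, 1001, -128, -156, 30, 15, -3, -1:] :: rat poly"
  let ?b = "[:4095, -20489, 24525, 36646, -103164, 22320, 137757, -113537, -75666, 131477, -1947, -79188,
      27726, 27436, -18153, -4951, 6330, 99, -1369, 160, 192, -34, -17, 3, 1:] :: rat poly"
  have "frag_cmul (int 27) infinity_divisor \<in> principal_divisors ?h ?f"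
  proof (rule infinity_divisor_multiple_principal)
    show "Polynomial.degree (?a - ?b * ?h) = 27" by simp
    show "Polynomial.degree ?b + 2 < 27" by simp
    show "?a\<^sup>2 - ?a * ?b * ?h - ?b\<^sup>2 * ?f = [:4096:]" by (simp add: power2_eq_square)
  qed
  moreover
  \<comment> \<open>With n = 10, l = 1 and k = 9, the product with conj g would have value 0 at
    \<open>plus_place\<close> and - 1 at \<open>minus_place\<close>.\<close>
  let ?a = "[:0, 1, 3, -8, -1, 4, -1, -1:] :: rat poly"
  let ?b = "[:16, -15, -11, 18, 1, -6, 1, 1:] :: rat poly"
  have "frag_cmul (int 9) infinity_divisor \<notin> principal_divisors ?h ?f"
  proof (rule infinity_divisor_multiple_not_principal)
    show "Polynomial.degree (?a - ?b * ?h) = 10" by simp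
    show "Polynomial.degree ?b + 2 < 10" by simp
    show "Polynomial.degree (?a\<^sup>2 - ?a * ?b * ?h - ?b\<^sup>2 * ?f) = 1" by (simp add: power2_eq_square)
  qed simp_all
  ultimately show "has_rational_torsion_of_order ?h ?f 27"
    using rational_torsion_infinity_prime_power[of 3 2] by simp
qed

lemma curve_2:
  "genus2_model [:2, -3, 3, 2:] [:6, 0, 0, 6:]" "has_rational_torsion_of_order [:2, -3, 3, 2:] [:6, 0, 0, 6:] 27"
proof -
  let ?h = "[:2, -3, 3, 2:] :: rat poly" and ?f = "[:6, 0, 0, 6:] :: rat poly"
  let ?d = "[:28, -12, 21, 14, -3, 12, 4:] :: rat poly"
  let ?r = "[:-25044, -6414, 21864, 25812, 6552:] :: rat poly"
  let ?s = "[:-3140, -912, -579, -4157, -4848, -1092:] :: rat poly"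
  show model: "genus2_model ?h ?f"
  proof (rule genus2_modelI)
    show "?d = ?h\<^sup>2 + smult 4 ?f" by (simp add: power2_eq_square)
    show "?r * ?d + ?s * pderiv ?d = [:-663552:]" by (simp add: pderiv_pCons)
  qed simp_all
  interpret genus2_curve ?h ?f
    by unfold_locales (use model in simp_all)
  let ?a = "[:4635023712, 3621015648, 9367965504, 22993180320, 21941563032, 35343503208, 50976938004,
      48662068572, 56951295642, 62742916218, 54436897350, 49837706640, 44610136296,
      33631099488, 24466252896, 17664904704, 11112529536, 6184871424, 3316351488, 1594920960,
      589658112, 150970368, 24846336, 2359296, 98304:] :: rat poly"
  let ?b = "[:-2816345504, -603502608, -6323102304, -10832744992, -9633511272, -19927707828, -24054364664,
      -23484242556, -30113567658, -30536164597, -26773526742, -25796091540, -22214134232,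
      -16617242256, -12512695008, -8905099840, -5458018176, -3076611840, -1657602560,
      -760691712, -260671488, -61616128, -9412608, -835584, -32768:] :: rat poly"
  have "frag_cmul (int 27) infinity_divisor \<in> principal_divisors ?h ?f"
  proof (rule infinity_divisor_multiple_principal)
    show "Polynomial.degree (?a - ?b * ?h) = 27" by simp
    show "Polynomial.degree ?b + 2 < 27" by simp
    show "?a\<^sup>2 - ?a * ?b * ?h - ?b\<^sup>2 * ?f = [:289207845356544:]" by (simp add: power2_eq_square)
  qed
  moreover
  \<comment> \<open>With n = 9, l = 1 and k = 9, the values at infinity would be - 1 and 0.\<close>
  let ?a = "[:-456, 54, 270, -246, 108, 216, 48:] :: rat poly"
  let ?b = "[:254, -174, 39, 112, -120, -96, -16:] :: rat poly"
  have "frag_cmul (int 9) infinity_divisor \<notin> principal_divisors ?h ?f"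
  proof (rule infinity_divisor_multiple_not_principal)
    show "Polynomial.degree (?a - ?b * ?h) = 9" by simp
    show "Polynomial.degree ?b + 2 < 9" by simp
    show "Polynomial.degree (?a\<^sup>2 - ?a * ?b * ?h - ?b\<^sup>2 * ?f) = 1" by (simp add: power2_eq_square)
  qed simp_all
  ultimately show "has_rational_torsion_of_order ?h ?f 27"
    using rational_torsion_infinity_prime_power[of 3 2] by simp
qed

lemma curve_3:
  "genus2_model [:-1, 6, 9, 6:] [:0, 0, -3:]" "has_rational_torsion_of_order [:-1, 6, 9, 6:] [:0, 0, -3:] 27"
proof -
  let ?h = "[:-1, 6, 9, 6:] :: rat poly" and ?f = "[:0, 0, -3:] :: rat poly"
  let ?d = "[:1, -12, 6, 96, 153, 108, 36:] :: rat poly"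
  let ?r = "[:1748, 10464, 17832, 14436, 5112:] :: rat poly"
  let ?s = "[:231, -645, -3205, -4317, -2832, -852:] :: rat poly"
  show model: "genus2_model ?h ?f"
  proof (rule genus2_modelI)
    show "?d = ?h\<^sup>2 + smult 4 ?f" by (simp add: power2_eq_square)
    show "?r * ?d + ?s * pderiv ?d = [:-1024:]" by (simp add: pderiv_pCons)
  qed simp_all
  interpret genus2_curve ?h ?f
    by unfold_locales (use model in simp_all)
  let ?a = "[:-27, -486, 12575055, -75604878, -567590625, 814201398, 14194825749, 39347389278,
      -23412413664, -504424998720, -1938265464384, -4677199915392, -8327485615104,
      -11613211398144, -13051680698880, -11986625866752, -9040347242496, -5587074662400,
      -2803158171648, -1121177272320, -346421919744, -78256668672, -11609505792, -859963392:] :: rat poly"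
  let ?b = "[:-4194277, 50332296, 88092453, -1610424492, -5395415931, 14983363152, 131310591255,
      290626890948, -258632577828, -3635795645568, -12961589150016, -30074395412736,
      -52526573335296, -72989903001600, -82900384022016, -78027097761792, -61218057222144,
      -40033947451392, -21700184850432, -9634886516736, -3434120478720, -950546202624,
      -193061781504, -25798901760, -1719926784:] :: rat poly"
  have "frag_cmul (int 27) infinity_divisor \<in> principal_divisors ?h ?f"
  proof (rule infinity_divisor_multiple_principal)
    show "Polynomial.degree (?a - ?b * ?h) = 27" by simp
    show "Polynomial.degree ?b + 2 < 27" by simp
    show "?a\<^sup>2 - ?a * ?b * ?h - ?b\<^sup>2 * ?f = [:113246208:]" by (simp add: power2_eq_square)
  qed
  moreover
  \<comment> \<open>With n = 9, l = 2 and k = 9, the values at infinity would be - 2 and 0; the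
    admissible pole order 2 is attained.\<close>
  let ?a = "[:3, 9, -84, -288, -288, -144:] :: rat poly"
  let ?b = "[:61, -27, -690, -1560, -1728, -1008, -288:] :: rat poly"
  have "frag_cmul (int 9) infinity_divisor \<notin> principal_divisors ?h ?f"
  proof (rule infinity_divisor_multiple_not_principal)
    show "Polynomial.degree (?a - ?b * ?h) = 9" by simp
    show "Polynomial.degree ?b + 2 < 9" by simp
    show "Polynomial.degree (?a\<^sup>2 - ?a * ?b * ?h - ?b\<^sup>2 * ?f) = 2" by (simp add: power2_eq_square)
  qed simp_all
  ultimately show "has_rational_torsion_of_order ?h ?f 27"
    using rational_torsion_infinity_prime_power[of 3 2] by simp
qed

lemma curve_4:
  "genus2_model [:-9, -7, 6, 6:] [:-2, -2:]" "has_rational_torsion_of_order [:-9, -7, 6, 6:] [:-2, -2:] 39"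
proof -
  let ?h = "[:-9, -7, 6, 6:] :: rat poly" and ?f = "[:-2, -2:] :: rat poly"
  let ?d = "[:73, 118, -59, -192, -48, 72, 36:] :: rat poly"
  let ?r = "[:-14539630, 31140672, 32756352, -20942784, -17192520:] :: rat poly"
  let ?s = "[:8651677, 3926315, -12516780, -7161324, 4445604, 2865420:] :: rat poly"
  show model: "genus2_model ?h ?f"
  proof (rule genus2_modelI)
    show "?d = ?h\<^sup>2 + smult 4 ?f" by (simp add: power2_eq_square)
    show "?r * ?d + ?s * pderiv ?d = [:-40495104:]" by (simp add: pderiv_pCons)
  qed simp_all
  interpret genus2_curve ?h ?f
    by unfold_locales (use model in simp_all)
  let ?a = "[:7246, 11760, -11040, -27216, -432, 20736, 6912, -5184, -2592:] :: rat poly"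
  let ?b = "[:-31781, -44988, 74706, 141120, -42408, -163296, -22896, 82944, 29808, -15552, -7776:] :: rat poly"
  have "frag_cmul (int 13) infinity_divisor \<in> principal_divisors ?h ?f"
  proof (rule infinity_divisor_multiple_principal)
    show "Polynomial.degree (?a - ?b * ?h) = 13" by simp
    show "Polynomial.degree ?b + 2 < 13" by simp
    show "?a\<^sup>2 - ?a * ?b * ?h - ?b\<^sup>2 * ?f = [:2304:]" by (simp add: power2_eq_square)
  qed
  moreover
  \<comment> \<open>The function y itself, of norm 2 x + 2: n = 3, l = 1 and k = 1, so the values at
    infinity would be 1 and - 2.\<close>
  let ?a = "0 :: rat poly"
  let ?b = "[:1:] :: rat poly"
  have "frag_cmul (int 1) infinity_divisor \<notin> principal_divisors ?h ?f"
  proof (rule infinity_divisor_multiple_not_principal)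
    show "Polynomial.degree (?a - ?b * ?h) = 3" by simp
    show "Polynomial.degree ?b + 2 < 3" by simp
    show "Polynomial.degree (?a\<^sup>2 - ?a * ?b * ?h - ?b\<^sup>2 * ?f) = 1" by (simp add: power2_eq_square)
  qed simp_all
  ultimately have D: "frag_cmul 13 infinity_divisor \<in> principal_divisors ?h ?f"
    "infinity_divisor \<notin> principal_divisors ?h ?f" by simp_all
  show "has_rational_torsion_of_order ?h ?f 39"
  proof (rule rational_torsion_39[OF _ _ D])
    \<comment> \<open>The line y = 2/9 meets the affine curve only at x = -1/3, with multiplicity
      three, and this is not a branch point.\<close>
    show "?f - smult (2 / 9) ?h - [:(2 / 9)\<^sup>2:] = smult (- 4 / 3) ([:- (- 1 / 3), 1:] ^ 3)"
      by (simp add: power2_eq_square power3_eq_cube)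
    show "poly ?h (- 1 / 3) + 2 * (2 / 9) \<noteq> 0" by simp
  qed
qed

theorem mainTheorem5:
  shows "(genus2_model [:1, -2, 0, 1:] [:0, 0, 0, 1:] \<and>
          has_rational_torsion_of_order [:1, -2, 0, 1:] [:0, 0, 0, 1:] 27) \<and>
         (genus2_model [:2, -3, 3, 2:] [:6, 0, 0, 6:] \<and>
          has_rational_torsion_of_order [:2, -3, 3, 2:] [:6, 0, 0, 6:] 27) \<and>
         (genus2_model [:-1, 6, 9, 6:] [:0, 0, -3:] \<and>
          has_rational_torsion_of_order [:-1, 6, 9, 6:] [:0, 0, -3:] 27) \<and>
         (genus2_model [:-9, -7, 6, 6:] [:-2, -2:] \<and>
          has_rational_torsion_of_order [:-9, -7, 6, 6:] [:-2, -2:] 39)"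
  using curve_1 curve_2 curve_3 curve_4 by blast

end
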